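(* For every integer $r\ge3$ with $r\neq5$ there exists a permutation $\sigma$ of $F^r$ with $\sigma(\mathbf 0)=\mathbf 0$ such that the extended perfect code $S_\sigma$ of length $2^{r+1}$ is neighbor transitive and non-Mollard.
   Context: $F=\mathrm{GF}(2)$, $\mathbf 0$ the all-zero vector. Index coordinates of $F^{2^r}$ by $F^r$; $e_a$ is the unit vector at $a$; $\mathcal H=\{x\in F^{2^r}:\sum_{a:x_a=1}a=\mathbf 0,\ \mathrm{wt}(x)\text{ even}\}$; $x|y$ is concatenation and $C\times D=\{x|y:x\in C,y\in D\}$; $S_\sigma=\bigcup_{a\in F^r}(\mathcal H+e_a+e_{\mathbf 0})\times(\mathcal H+e_{\sigma(a)}+e_{\sigma(\mathbf 0)})$. Codes $C,D\subseteq F^n$ are isomorphic if $x+\pi(C)=D$ for some $x$ and coordinate permutation $\pi$ ($\pi(y)_i=y_{\pi^{-1}(i)}$). $\mathrm{Aut}(C)$ is the stabilizer of $C$ in the group of maps $y\mapsto x+\pi(y)$; $C$ is neighbor transitive if $\mathrm{Aut}(C)$ acts transitively on $C$ and on the set of words at distance exactly $1$ from $C$. For binary extended perfect codes $C$ (length $t$), $D$ (length $m$) and $\phi:C\to F^m$, the Mollard code is $\{z\in F^{tm}:p_1(z)\in C,\ p_2(z)\in\phi(p_1(z))+D\}$, with coordinates $(i,s)$ and $p_1(z)=(\sum_s z_{1s},\ldots,\sum_s z_{ts})$, $p_2(z)=(\sum_i z_{i1},\ldots,\sum_i z_{im})$. A code is non-Mollard if it is not isomorphic to any Mollard code. *)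

theory Defs
  imports Main
begin

text \<open>A binary word with coordinates in I is a function I \<to> bool; we represent it
  as a total function that is False outside I.  Addition is coordinatewise xor.\<close>

definition words :: "'i set \<Rightarrow> ('i \<Rightarrow> bool) set" where
  "words I = {x. \<forall>i. i \<notin> I \<longrightarrow> \<not> x i}"

definition vadd :: "('i \<Rightarrow> bool) \<Rightarrow> ('i \<Rightarrow> bool) \<Rightarrow> ('i \<Rightarrow> bool)" where
  "vadd x y = (\<lambda>i. x i \<noteq> y i)"

definition hdist :: "'i set \<Rightarrow> ('i \<Rightarrow> bool) \<Rightarrow> ('i \<Rightarrow> bool) \<Rightarrow> nat" where
  "hdist I x y = card {i\<in>I. x i \<noteq> y i}"

definition perm_word :: "'i set \<Rightarrow> ('i \<Rightarrow> 'j) \<Rightarrow> ('i \<Rightarrow> bool) \<Rightarrow> ('j \<Rightarrow> bool)" where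
  "perm_word I \<pi> y = (\<lambda>j. if j \<in> \<pi> ` I then y (inv_into I \<pi> j) else False)"

definition code_iso :: "'i set \<Rightarrow> ('i \<Rightarrow> bool) set \<Rightarrow> 'j set \<Rightarrow> ('j \<Rightarrow> bool) set \<Rightarrow> bool" where
  "code_iso I C J D \<longleftrightarrow>
     (\<exists>x \<pi>. x \<in> words J \<and> bij_betw \<pi> I J \<and> D = (\<lambda>y. vadd x (perm_word I \<pi> y)) ` C)"

definition Aut :: "'i set \<Rightarrow> ('i \<Rightarrow> bool) set \<Rightarrow> (('i \<Rightarrow> bool) \<times> ('i \<Rightarrow> 'i)) set" where
  "Aut I C = {(x, \<pi>). x \<in> words I \<and> bij_betw \<pi> I I
                    \<and> (\<lambda>y. vadd x (perm_word I \<pi> y)) ` C = C}"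

definition neighbors :: "'i set \<Rightarrow> ('i \<Rightarrow> bool) set \<Rightarrow> ('i \<Rightarrow> bool) set" where
  "neighbors I C = {y \<in> words I. y \<notin> C \<and> (\<exists>c\<in>C. hdist I y c = 1)}"

definition transitive_on :: "'i set \<Rightarrow> (('i \<Rightarrow> bool) \<times> ('i \<Rightarrow> 'i)) set \<Rightarrow> ('i \<Rightarrow> bool) set \<Rightarrow> bool" where
  "transitive_on I G A \<longleftrightarrow>
     (\<forall>u\<in>A. \<forall>v\<in>A. \<exists>(x, \<pi>)\<in>G. vadd x (perm_word I \<pi> u) = v)"

definition neighbor_transitive :: "'i set \<Rightarrow> ('i \<Rightarrow> bool) set \<Rightarrow> bool" where
  "neighbor_transitive I C \<longleftrightarrow>
     transitive_on I (Aut I C) C \<and> transitive_on I (Aut I C) (neighbors I C)"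

text \<open>Binary extended perfect code of length n = card I (n \<ge> 2, i.e. the extension of a
  perfect code of length n-1 \<ge> 1): minimum distance at least 4 and |C| = 2^(n-1)/n.\<close>
definition ext_perfect :: "'i set \<Rightarrow> ('i \<Rightarrow> bool) set \<Rightarrow> bool" where
  "ext_perfect I C \<longleftrightarrow> finite I \<and> card I \<ge> 2 \<and> C \<subseteq> words I
     \<and> card C * card I = 2 ^ (card I - 1)
     \<and> (\<forall>c\<in>C. \<forall>d\<in>C. c \<noteq> d \<longrightarrow> hdist I c d \<ge> 4)"

definition mp1 :: "nat \<Rightarrow> nat \<Rightarrow> (nat \<times> nat \<Rightarrow> bool) \<Rightarrow> (nat \<Rightarrow> bool)" where
  "mp1 t m z = (\<lambda>i. i < t \<and> odd (card {s\<in>{..<m}. z (i, s)}))"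

definition mp2 :: "nat \<Rightarrow> nat \<Rightarrow> (nat \<times> nat \<Rightarrow> bool) \<Rightarrow> (nat \<Rightarrow> bool)" where
  "mp2 t m z = (\<lambda>s. s < m \<and> odd (card {i\<in>{..<t}. z (i, s)}))"

definition mollard :: "nat \<Rightarrow> nat \<Rightarrow> (nat \<Rightarrow> bool) set \<Rightarrow> (nat \<Rightarrow> bool) set
     \<Rightarrow> ((nat \<Rightarrow> bool) \<Rightarrow> (nat \<Rightarrow> bool)) \<Rightarrow> (nat \<times> nat \<Rightarrow> bool) set" where
  "mollard t m C D \<phi> = {z \<in> words ({..<t} \<times> {..<m}).
      mp1 t m z \<in> C \<and> mp2 t m z \<in> (\<lambda>d. vadd (\<phi> (mp1 t m z)) d) ` D}"

definition non_mollard :: "'i set \<Rightarrow> ('i \<Rightarrow> bool) set \<Rightarrow> bool" where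
  "non_mollard I S \<longleftrightarrow>
     \<not> (\<exists>t m C D \<phi>. ext_perfect {..<t} C \<and> ext_perfect {..<m} D
          \<and> (\<forall>c\<in>C. \<phi> c \<in> words {..<m})
          \<and> code_iso I S ({..<t} \<times> {..<m}) (mollard t m C D \<phi>))"

definition vec :: "nat \<Rightarrow> (nat \<Rightarrow> bool) set" where
  "vec r = {a. \<forall>i. r \<le> i \<longrightarrow> \<not> a i}"

definition vzero :: "nat \<Rightarrow> bool" where
  "vzero = (\<lambda>_. False)"

definition vsum :: "(nat \<Rightarrow> bool) set \<Rightarrow> (nat \<Rightarrow> bool)" where
  "vsum A = (\<lambda>i. odd (card {a\<in>A. a i}))"

definition unitv :: "(nat \<Rightarrow> bool) \<Rightarrow> ((nat \<Rightarrow> bool) \<Rightarrow> bool)" where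
  "unitv a = (\<lambda>b. b = a)"

definition Hcode :: "nat \<Rightarrow> ((nat \<Rightarrow> bool) \<Rightarrow> bool) set" where
  "Hcode r = {x \<in> words (vec r). vsum {a\<in>vec r. x a} = vzero
                \<and> even (card {a\<in>vec r. x a})}"

definition concat :: "('a \<Rightarrow> bool) \<Rightarrow> ('a \<Rightarrow> bool) \<Rightarrow> ('a + 'a \<Rightarrow> bool)" where
  "concat x y = (\<lambda>i. case i of Inl a \<Rightarrow> x a | Inr a \<Rightarrow> y a)"

definition Scoords :: "nat \<Rightarrow> ((nat \<Rightarrow> bool) + (nat \<Rightarrow> bool)) set" where
  "Scoords r = vec r <+> vec r"

definition Scode :: "nat \<Rightarrow> ((nat \<Rightarrow> bool) \<Rightarrow> (nat \<Rightarrow> bool))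
     \<Rightarrow> ((nat \<Rightarrow> bool) + (nat \<Rightarrow> bool) \<Rightarrow> bool) set" where
  "Scode r \<sigma> = (\<Union>a\<in>vec r.
      {concat x y | x y.
         x \<in> (\<lambda>h. vadd (vadd h (unitv a)) (unitv vzero)) ` Hcode r
       \<and> y \<in> (\<lambda>h. vadd (vadd h (unitv (\<sigma> a))) (unitv (\<sigma> vzero))) ` Hcode r})"

end

theory Submission
  imports Defs
begin

text \<open>
  A word \<open>x|y\<close> lies in \<open>S\<^sub>\<sigma>\<close> iff both halves have even weight and \<open>\<sigma>\<close> maps the sum of the support of
  \<open>x\<close> to that of \<open>y\<close>. An affine permutation of the coordinates of a half acts on these sums by its
  linear part. Hence, if \<open>\<sigma>\<close> is an involution and \<open>\<sigma> (L a s + a) = L (\<sigma> a) (\<sigma> s) + \<sigma> a\<close> for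
  invertible linear maps \<open>L a\<close>, then \<open>0\<close> can be moved to any code word, and combining this with
  translations of a half and with the exchange of the halves gives neighbour transitivity.

  If no \<open>a \<noteq> 0\<close> satisfies \<open>\<sigma> (s + a) = \<sigma> s + \<sigma> a\<close> for all \<open>s\<close>, then the kernel of \<open>S\<^sub>\<sigma>\<close> is
  \<open>\<H> \<times> \<H>\<close>, so its words of weight 4 lie in a single half. In a Mollard code all rectangles
  of the coordinate grid lie in the kernel, which would put the whole grid into one half.

  Both properties of \<open>\<sigma>\<close> pass to direct sums. There are examples for \<open>r = 3\<close> and \<open>r = 4\<close>, and these
  two numbers generate all \<open>r \<ge> 3\<close> except 5.
\<close>

section \<open>Parities and sums of binary vectors\<close>

lemma even_card_xor:
  assumes "finite A"
  shows "even (card {i\<in>A. x i \<noteq> y i}) \<longleftrightarrow> even (card {i\<in>A. x i}) = even (card {i\<in>A. y i})"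
  using assms
proof (induction A)
  case (insert a A)
  have "{i \<in> insert a A. P i} = (if P a then insert a {i\<in>A. P i} else {i\<in>A. P i})" for P
    by auto
  with insert show ?case
    by auto
qed simp

lemma vadd_in_words: "x \<in> words I \<Longrightarrow> y \<in> words I \<Longrightarrow> vadd x y \<in> words I"
  by (auto simp: words_def vadd_def)

lemma vadd_in_vec: "x \<in> vec r \<Longrightarrow> y \<in> vec r \<Longrightarrow> vadd x y \<in> vec r"
  by (auto simp: vec_def vadd_def)

lemma vadd_self [simp]: "vadd x x = (\<lambda>_. False)"
  by (simp add: vadd_def)

lemma vadd_zero [simp]: "vadd x (\<lambda>_. False) = x" "vadd (\<lambda>_. False) x = x"
  by (simp_all add: vadd_def)

lemma vadd_vzero [simp]: "vadd x vzero = x" "vadd vzero x = x"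
  by (simp_all add: vzero_def)

lemma vadd_assoc: "vadd (vadd x y) z = vadd x (vadd y z)"
  by (auto simp: vadd_def)

lemma vadd_commute: "vadd x y = vadd y x"
  by (auto simp: vadd_def)

lemma vadd_left_commute: "vadd x (vadd y z) = vadd y (vadd x z)"
  by (auto simp: vadd_def)

lemma vadd_cancel [simp]: "vadd x (vadd x y) = y"
  by (auto simp: vadd_def)

lemma vadd_eq_zero_iff: "vadd x y = (\<lambda>_. False) \<longleftrightarrow> x = y"
  by (auto simp: vadd_def fun_eq_iff)

lemma vadd_left_cancel [simp]: "vadd x y = vadd x z \<longleftrightarrow> y = z"
  by (auto simp: vadd_def fun_eq_iff)

lemma vadd_right_cancel [simp]: "vadd y x = vadd z x \<longleftrightarrow> y = z"
  by (auto simp: vadd_def fun_eq_iff)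

lemma finite_words_and_card:
  assumes "finite I"
  shows "finite (words I) \<and> card (words I) = 2 ^ card I"
proof -
  have "bij_betw (\<lambda>x. {i. x i}) (words I) (Pow I)"
    by (rule bij_betw_byWitness[where f' = "\<lambda>A i. i \<in> A"]) (auto simp: words_def)
  then show ?thesis
    using assms by (metis bij_betw_finite bij_betw_same_card card_Pow finite_Pow_iff)
qed

lemma vec_eq_words: "vec r = words {..<r}"
  by (auto simp: vec_def words_def not_less)

lemma finite_vec [simp]: "finite (vec r)"
  and card_vec: "card (vec r) = 2 ^ r"
  using finite_words_and_card[of "{..<r}"] by (simp_all add: vec_eq_words)

lemma vzero_in_vec [simp]: "vzero \<in> vec r"
  by (simp add: vzero_def vec_def)

text \<open>Adding the unit vector at a fixed \<open>j\<close> exchanges the words of odd and of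
  even weight, so each class is half of the space. The count is later matched with code words times
  coordinates.\<close>

lemma card_odd_words:
  assumes "finite I" "I \<noteq> {}"
  shows "card {z \<in> words I. odd (card {i\<in>I. z i})} = 2 ^ (card I - 1)"
proof -
  obtain j where j: "j \<in> I"
    using assms by blast
  let ?O = "{z \<in> words I. odd (card {i\<in>I. z i})}"
  let ?E = "{z \<in> words I. even (card {i\<in>I. z i})}"
  let ?u = "\<lambda>i. i = j"
  have "{i\<in>I. ?u i} = {j}"
    using j by auto
  then have u: "odd (card {i\<in>I. ?u i})"
    by simp
  have par: "odd (card {i\<in>I. vadd ?u z i}) \<longleftrightarrow> even (card {i\<in>I. z i})" for z
    using even_card_xor[OF assms(1), of ?u z] u by (simp add: vadd_def)
  have uw: "?u \<in> words I"
    using j by (auto simp: words_def)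
  have "bij_betw (vadd ?u) ?O ?E"
    by (rule bij_betw_byWitness[where f' = "vadd ?u"])
      (use par uw vadd_in_words in \<open>auto simp del: One_nat_def\<close>)
  then have eq: "card ?O = card ?E"
    by (rule bij_betw_same_card)
  have "card (?O \<union> ?E) = card ?O + card ?E"
    using finite_words_and_card[OF assms(1)] by (intro card_Un_disjoint) auto
  moreover have "?O \<union> ?E = words I"
    by auto
  ultimately have "2 * card ?O = 2 ^ card I"
    using eq finite_words_and_card[OF assms(1)] by simp
  moreover have "card I \<noteq> 0"
    using assms by simp
  ultimately show ?thesis
    by (cases "card I") simp_all
qed

lemma vsum_empty [simp]: "vsum {} = (\<lambda>_. False)"
  by (simp add: vsum_def)

lemma vsum_xor:
  assumes "finite A"
  shows "vsum {i\<in>A. x i \<noteq> y i} = vadd (vsum {i\<in>A. x i}) (vsum {i\<in>A. y i})"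
proof
  fix k
  have "{a \<in> {i\<in>A. P i}. a k} = {i \<in> {i\<in>A. i k}. P i}" for P
    by auto
  then show "vsum {i\<in>A. x i \<noteq> y i} k = vadd (vsum {i\<in>A. x i}) (vsum {i\<in>A. y i}) k"
    using even_card_xor[of "{i\<in>A. i k}" x y] assms by (simp add: vsum_def vadd_def)
qed

lemma vsum_insert:
  assumes "finite A" "a \<notin> A"
  shows "vsum (insert a A) = vadd a (vsum A)"
proof
  fix k
  have "{b \<in> insert a A. b k} = (if a k then insert a {b\<in>A. b k} else {b\<in>A. b k})"
    by auto
  then show "vsum (insert a A) k = vadd a (vsum A) k"
    using assms by (simp add: vsum_def vadd_def)
qed

lemma vsum_singleton [simp]: "vsum {a} = a"
  by (simp add: vsum_insert)

lemma vsum_in_vec: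
  assumes "A \<subseteq> vec r"
  shows "vsum A \<in> vec r"
proof -
  have "\<not> vsum A k" if "r \<le> k" for k
  proof -
    have "{a\<in>A. a k} = {}"
      using assms that by (auto simp: vec_def)
    then show ?thesis
      by (simp only: vsum_def card.empty) simp
  qed
  then show ?thesis
    by (simp add: vec_def)
qed

text \<open>Over GF(2) only equal vectors cancel. This excludes weight 2 for a half with sum zero,
  both in the distance bound and for kernel words.\<close>

lemma vsum_card_two_nonzero:
  assumes "card A = 2"
  shows "vsum A \<noteq> (\<lambda>_. False)"
proof -
  obtain a b where "A = {a, b}" "a \<noteq> b"
    using assms by (auto simp: card_2_iff)
  then show ?thesis
    by (simp add: vsum_insert vadd_eq_zero_iff)
qed

text \<open>Over GF(2) additivity is the same as linearity.\<close>

definition additive_on :: "nat \<Rightarrow> ((nat \<Rightarrow> bool) \<Rightarrow> (nat \<Rightarrow> bool)) \<Rightarrow> bool" where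
  "additive_on r M \<longleftrightarrow> (\<forall>s\<in>vec r. \<forall>t\<in>vec r. M (vadd s t) = vadd (M s) (M t))"

lemma additive_on_zero:
  assumes "additive_on r M"
  shows "M (\<lambda>_. False) = (\<lambda>_. False)"
proof -
  have "(\<lambda>_. False) \<in> vec r"
    by (simp add: vec_def)
  then have "M (vadd (\<lambda>_. False) (\<lambda>_. False)) = vadd (M (\<lambda>_. False)) (M (\<lambda>_. False))"
    using assms unfolding additive_on_def by blast
  then show ?thesis
    by simp
qed

text \<open>The constant \<open>c\<close> is added once per element, so it cancels when
  \<open>card A\<close> is even; injectivity of \<open>M\<close> keeps the images distinct. On even
  supports an affine map therefore acts through its linear part alone.\<close>

lemma vsum_affine_image:
  assumes "additive_on r M" "inj_on M (vec r)" "finite A" "A \<subseteq> vec r"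
  shows "vsum ((\<lambda>s. vadd (M s) c) ` A)
    = vadd (M (vsum A)) (if odd (card A) then c else (\<lambda>_. False))"
  using assms(3,4)
proof (induction A)
  case empty
  then show ?case
    using additive_on_zero[OF assms(1)] by simp
next
  case (insert a A)
  have "vadd (M a) c \<notin> (\<lambda>s. vadd (M s) c) ` A"
    using insert inj_onD[OF assms(2), of a] by auto
  moreover have "M (vadd a (vsum A)) = vadd (M a) (M (vsum A))"
    using insert assms(1) vsum_in_vec by (auto simp: additive_on_def)
  ultimately show ?case
    using insert by (auto simp: vsum_insert vadd_def fun_eq_iff)
qed

section \<open>The group of automorphisms of a code\<close>

lemma perm_word_apply:
  assumes "bij_betw \<pi> I J" "i \<in> I"
  shows "perm_word I \<pi> y (\<pi> i) = y i"
  using assms by (auto simp: perm_word_def bij_betw_def)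

lemma perm_word_in_words:
  assumes "bij_betw \<pi> I J"
  shows "perm_word I \<pi> y \<in> words J"
  using assms by (auto simp: perm_word_def words_def bij_betw_def)

lemma words_eqI:
  assumes "x \<in> words I" "y \<in> words I" "\<And>i. i \<in> I \<Longrightarrow> x i = y i"
  shows "x = y"
  using assms by (auto simp: words_def fun_eq_iff)

lemma perm_word_vadd: "perm_word I \<pi> (vadd x y) = vadd (perm_word I \<pi> x) (perm_word I \<pi> y)"
  by (auto simp: perm_word_def vadd_def fun_eq_iff)

lemma perm_word_comp:
  assumes "bij_betw \<rho> I J" "bij_betw \<pi> J K"
  shows "perm_word J \<pi> (perm_word I \<rho> y) = perm_word I (\<pi> \<circ> \<rho>) y"
proof (rule words_eqI)
  note c = bij_betw_trans[OF assms]
  show "perm_word J \<pi> (perm_word I \<rho> y) \<in> words K" "perm_word I (\<pi> \<circ> \<rho>) y \<in> words K"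
    using perm_word_in_words assms(2) c by blast+
  fix k assume "k \<in> K"
  then obtain i where i: "i \<in> I" "k = (\<pi> \<circ> \<rho>) i"
    using c by (auto simp: bij_betw_def)
  then have "\<rho> i \<in> J"
    using assms(1) by (auto simp: bij_betw_def)
  then show "perm_word J \<pi> (perm_word I \<rho> y) k = perm_word I (\<pi> \<circ> \<rho>) y k"
    using i perm_word_apply assms c by (metis comp_apply)
qed

lemma perm_word_inv_into:
  assumes "bij_betw \<pi> I J" "y \<in> words I"
  shows "perm_word J (inv_into I \<pi>) (perm_word I \<pi> y) = y"
proof (rule words_eqI)
  note inv = bij_betw_inv_into[OF assms(1)]
  show "perm_word J (inv_into I \<pi>) (perm_word I \<pi> y) \<in> words I"
    by (rule perm_word_in_words[OF inv])
  fix i assume "i \<in> I"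
  then have "\<pi> i \<in> J" "inv_into I \<pi> (\<pi> i) = i"
    using assms(1) by (auto simp: bij_betw_def)
  then show "perm_word J (inv_into I \<pi>) (perm_word I \<pi> y) i = y i"
    using perm_word_apply[OF inv] perm_word_apply[OF assms(1) \<open>i \<in> I\<close>] by metis
qed (rule assms(2))

lemma inj_on_perm_word:
  assumes "bij_betw \<pi> I J"
  shows "inj_on (\<lambda>y. vadd x (perm_word I \<pi> y)) (words I)"
  using assms by (intro inj_onI) (metis perm_word_inv_into vadd_left_cancel)

text \<open>This is the product in the semidirect product of translations and coordinate
  permutations: \<open>\<pi>\<close> acts linearly, so the inner translation comes out as
  \<open>perm_word I \<pi> y\<close>.\<close>

lemma Aut_compose:
  assumes "(x, \<pi>) \<in> Aut I C" "(y, \<rho>) \<in> Aut I C"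
  shows "(vadd x (perm_word I \<pi> y), \<pi> \<circ> \<rho>) \<in> Aut I C"
    and "vadd (vadd x (perm_word I \<pi> y)) (perm_word I (\<pi> \<circ> \<rho>) z)
      = vadd x (perm_word I \<pi> (vadd y (perm_word I \<rho> z)))"
proof -
  have b: "bij_betw \<pi> I I" "bij_betw \<rho> I I"
    using assms by (auto simp: Aut_def)
  have eq: "vadd (vadd x (perm_word I \<pi> y)) (perm_word I (\<pi> \<circ> \<rho>) z)
      = vadd x (perm_word I \<pi> (vadd y (perm_word I \<rho> z)))" for z
    by (simp add: perm_word_vadd vadd_assoc perm_word_comp[OF b(2,1)])
  then have "(\<lambda>z. vadd (vadd x (perm_word I \<pi> y)) (perm_word I (\<pi> \<circ> \<rho>) z)) ` C
      = (\<lambda>z. vadd x (perm_word I \<pi> z)) ` (\<lambda>z. vadd y (perm_word I \<rho> z)) ` C"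
    by (simp add: image_image)
  also have "\<dots> = C"
    using assms by (simp add: Aut_def)
  finally show "(vadd x (perm_word I \<pi> y), \<pi> \<circ> \<rho>) \<in> Aut I C"
    using assms b by (auto simp: Aut_def vadd_in_words perm_word_in_words bij_betw_trans)
  show "vadd (vadd x (perm_word I \<pi> y)) (perm_word I (\<pi> \<circ> \<rho>) z)
      = vadd x (perm_word I \<pi> (vadd y (perm_word I \<rho> z)))"
    by (rule eq)
qed

lemma Aut_inverse:
  assumes "(x, \<pi>) \<in> Aut I C" "C \<subseteq> words I"
  obtains y \<rho> where "(y, \<rho>) \<in> Aut I C"
    and "\<And>z. z \<in> words I \<Longrightarrow> vadd y (perm_word I \<rho> (vadd x (perm_word I \<pi> z))) = z"
proof
  let ?\<rho> = "inv_into I \<pi>"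
  \<comment> \<open>Solving \<open>v = x + \<pi> z\<close> for \<open>z\<close> gives the inverse
    permutation applied to \<open>v\<close> plus the same applied to \<open>x\<close>; over GF(2) no
    sign appears.\<close>
  let ?y = "perm_word I ?\<rho> x"
  have b: "bij_betw \<pi> I I" and C: "(\<lambda>y. vadd x (perm_word I \<pi> y)) ` C = C"
    using assms by (auto simp: Aut_def)
  show inv: "vadd ?y (perm_word I ?\<rho> (vadd x (perm_word I \<pi> z))) = z" if "z \<in> words I" for z
    by (simp add: perm_word_vadd perm_word_inv_into[OF b that])
  have "(\<lambda>z. vadd ?y (perm_word I ?\<rho> z)) ` (\<lambda>y. vadd x (perm_word I \<pi> y)) ` C = C"
    using inv assms(2) by (force simp: image_image)
  then show "(?y, ?\<rho>) \<in> Aut I C"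
    using C bij_betw_inv_into[OF b] perm_word_in_words by (auto simp: Aut_def)
qed

text \<open>Any \<open>u\<close> and \<open>v\<close> are linked through the base point
  \<open>w\<close>: undo the automorphism that leads to \<open>u\<close>, then apply the one that
  leads to \<open>v\<close>.\<close>

lemma transitive_on_Aut_from_point:
  assumes "C \<subseteq> words I" "w \<in> words I"
    and "\<And>v. v \<in> A \<Longrightarrow> \<exists>(x, \<pi>)\<in>Aut I C. vadd x (perm_word I \<pi> w) = v"
  shows "transitive_on I (Aut I C) A"
  unfolding transitive_on_def
proof (intro ballI)
  fix u v assume "u \<in> A" "v \<in> A"
  then obtain x \<pi> x' \<pi>' where u: "(x, \<pi>) \<in> Aut I C" "vadd x (perm_word I \<pi> w) = u"
    and v: "(x', \<pi>') \<in> Aut I C" "vadd x' (perm_word I \<pi>' w) = v"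
    using assms(3) by blast
  obtain y \<rho> where y: "(y, \<rho>) \<in> Aut I C"
    "\<And>z. z \<in> words I \<Longrightarrow> vadd y (perm_word I \<rho> (vadd x (perm_word I \<pi> z))) = z"
    using Aut_inverse[OF u(1) assms(1)] by blast
  have "vadd y (perm_word I \<rho> u) = w"
    using y(2)[OF assms(2)] u(2) by simp
  then have "vadd (vadd x' (perm_word I \<pi>' y)) (perm_word I (\<pi>' \<circ> \<rho>) u) = v"
    using Aut_compose(2)[OF v(1) y(1)] v(2) by simp
  then show "\<exists>(x, \<pi>)\<in>Aut I C. vadd x (perm_word I \<pi> u) = v"
    by (intro bexI[OF _ Aut_compose(1)[OF v(1) y(1)]]) simp
qed

text \<open>Automorphisms taking \<open>0\<close> to \<open>c\<close> and the unit vector at \<open>j\<close> to any prescribed neighbour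
  of \<open>c\<close> act transitively on code words and on neighbours at once.\<close>

lemma neighbor_transitiveI:
  assumes "finite I" "C \<subseteq> words I" "j \<in> I"
    and "\<And>c i. c \<in> C \<Longrightarrow> i \<in> I \<Longrightarrow> \<exists>\<pi>. \<pi> j = i \<and> (c, \<pi>) \<in> Aut I C"
  shows "neighbor_transitive I C"
  unfolding neighbor_transitive_def
proof
  show "transitive_on I (Aut I C) C"
  proof (rule transitive_on_Aut_from_point[OF assms(2)])
    show "(\<lambda>_. False) \<in> words I"
      by (simp add: words_def)
    fix v assume "v \<in> C"
    then obtain \<pi> where "(v, \<pi>) \<in> Aut I C"
      using assms(3,4) by blast
    moreover have "perm_word I \<pi> (\<lambda>_. False) = (\<lambda>_. False)"
      by (simp add: perm_word_def)
    ultimately show "\<exists>(x, \<pi>)\<in>Aut I C. vadd x (perm_word I \<pi> (\<lambda>_. False)) = v"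
      by (auto intro!: bexI[of _ "(v, \<pi>)"])
  qed
  show "transitive_on I (Aut I C) (neighbors I C)"
  proof (rule transitive_on_Aut_from_point[OF assms(2)])
    show "(\<lambda>i. i = j) \<in> words I"
      using assms(3) by (auto simp: words_def)
    fix v assume "v \<in> neighbors I C"
    then obtain c where v: "v \<in> words I" and c: "c \<in> C" and "card {i\<in>I. v i \<noteq> c i} = 1"
      by (auto simp: neighbors_def hdist_def)
    then obtain i where i: "{i\<in>I. v i \<noteq> c i} = {i}"
      by (auto simp: card_1_singleton_iff)
    then have "i \<in> I"
      by auto
    then obtain \<pi> where \<pi>: "\<pi> j = i" "(c, \<pi>) \<in> Aut I C"
      using assms(4) c by blast
    then have b: "bij_betw \<pi> I I"
      by (simp add: Aut_def)
    \<comment> \<open>The neighbour \<open>v\<close> is \<open>c\<close> plus the unit vector at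
      \<open>i\<close>, and \<open>\<pi>\<close> carries the unit vector at \<open>j\<close> to that
      one.\<close>
    have "vadd c (perm_word I \<pi> (\<lambda>i. i = j)) = v"
    proof (rule words_eqI)
      show "vadd c (perm_word I \<pi> (\<lambda>i. i = j)) \<in> words I" "v \<in> words I"
        using c assms(2) v perm_word_in_words[OF b] by (auto intro: vadd_in_words)
      fix k assume "k \<in> I"
      then obtain l where l: "l \<in> I" "k = \<pi> l"
        using b by (auto simp: bij_betw_def)
      then have "l = j \<longleftrightarrow> k = i"
        using b \<pi>(1) assms(3) by (auto simp: bij_betw_def dest: inj_onD)
      then have "perm_word I \<pi> (\<lambda>i. i = j) k \<longleftrightarrow> k = i"
        using perm_word_apply[OF b l(1)] l(2) by simp
      then show "vadd c (perm_word I \<pi> (\<lambda>i. i = j)) k = v k"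
        using i \<open>k \<in> I\<close> by (auto simp: vadd_def)
    qed
    then show "\<exists>(x, \<pi>)\<in>Aut I C. vadd x (perm_word I \<pi> (\<lambda>i. i = j)) = v"
      using \<pi>(2) by (auto intro!: bexI[of _ "(c, \<pi>)"])
  qed
qed

section \<open>The codes of the construction\<close>

definition lsupp :: "nat \<Rightarrow> ((nat \<Rightarrow> bool) + (nat \<Rightarrow> bool) \<Rightarrow> bool) \<Rightarrow> (nat \<Rightarrow> bool) set" where
  "lsupp r z = {a\<in>vec r. z (Inl a)}"

definition rsupp :: "nat \<Rightarrow> ((nat \<Rightarrow> bool) + (nat \<Rightarrow> bool) \<Rightarrow> bool) \<Rightarrow> (nat \<Rightarrow> bool) set" where
  "rsupp r z = {a\<in>vec r. z (Inr a)}"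

lemma lsupp_subset [simp]: "lsupp r z \<subseteq> vec r" and rsupp_subset [simp]: "rsupp r z \<subseteq> vec r"
  by (auto simp: lsupp_def rsupp_def)

lemma finite_lsupp [simp]: "finite (lsupp r z)" and finite_rsupp [simp]: "finite (rsupp r z)"
  by (auto simp: lsupp_def rsupp_def)

lemma lsupp_vadd:
  "even (card (lsupp r (vadd y z))) \<longleftrightarrow> even (card (lsupp r y)) = even (card (lsupp r z))"
  "vsum (lsupp r (vadd y z)) = vadd (vsum (lsupp r y)) (vsum (lsupp r z))"
  using even_card_xor[of "vec r" "\<lambda>a. y (Inl a)" "\<lambda>a. z (Inl a)"]
    vsum_xor[of "vec r" "\<lambda>a. y (Inl a)" "\<lambda>a. z (Inl a)"]
  by (simp_all add: lsupp_def vadd_def)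

lemma rsupp_vadd:
  "even (card (rsupp r (vadd y z))) \<longleftrightarrow> even (card (rsupp r y)) = even (card (rsupp r z))"
  "vsum (rsupp r (vadd y z)) = vadd (vsum (rsupp r y)) (vsum (rsupp r z))"
  using even_card_xor[of "vec r" "\<lambda>a. y (Inr a)" "\<lambda>a. z (Inr a)"]
    vsum_xor[of "vec r" "\<lambda>a. y (Inr a)" "\<lambda>a. z (Inr a)"]
  by (simp_all add: rsupp_def vadd_def)

lemma finite_Scoords [simp]: "finite (Scoords r)"
  and card_Scoords: "card (Scoords r) = 2 ^ (r + 1)"
  by (simp_all add: Scoords_def card_Plus card_vec)

lemma Inl_in_Scoords [simp]: "Inl a \<in> Scoords r \<longleftrightarrow> a \<in> vec r"
  and Inr_in_Scoords [simp]: "Inr a \<in> Scoords r \<longleftrightarrow> a \<in> vec r"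
  by (auto simp: Scoords_def)

lemma card_Scoords_filter:
  "card {i\<in>Scoords r. z i} = card (lsupp r z) + card (rsupp r z)"
proof -
  have "{i\<in>Scoords r. z i} = lsupp r z <+> rsupp r z"
    by (auto simp: Scoords_def lsupp_def rsupp_def)
  then show ?thesis
    by (simp add: card_Plus)
qed

lemma hdist_Scoords:
  "hdist (Scoords r) y z = card (lsupp r (vadd y z)) + card (rsupp r (vadd y z))"
  using card_Scoords_filter[of r "vadd y z"] by (simp add: hdist_def vadd_def)

lemma Scoords_word_eqI:
  assumes "y \<in> words (Scoords r)" "z \<in> words (Scoords r)"
    "lsupp r y = lsupp r z" "rsupp r y = rsupp r z"
  shows "y = z"
proof (rule words_eqI[OF assms(1,2)])
  fix i assume "i \<in> Scoords r"
  then show "y i = z i"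
    using assms(3,4) unfolding Scoords_def lsupp_def rsupp_def by blast
qed

text \<open>Adding the unit vectors at \<open>a\<close> and \<open>b\<close> keeps the parity of the
  weight and shifts the sum of the support by \<open>a + b\<close>, also when the two
  coincide.\<close>

lemma mem_coset_Hcode:
  assumes "a \<in> vec r" "b \<in> vec r"
  shows "x \<in> (\<lambda>h. vadd (vadd h (unitv a)) (unitv b)) ` Hcode r \<longleftrightarrow>
    x \<in> words (vec r) \<and> even (card {c\<in>vec r. x c}) \<and> vsum {c\<in>vec r. x c} = vadd a b"
proof -
  let ?u = "vadd (unitv a) (unitv b)"
  have uw: "?u \<in> words (vec r)"
    using assms by (auto simp: words_def vadd_def unitv_def)
  have s: "{c\<in>vec r. unitv d c} = {d}" if "d \<in> vec r" for d
    using that by (auto simp: unitv_def)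
  have par: "even (card {c\<in>vec r. vadd y z c})
      \<longleftrightarrow> even (card {c\<in>vec r. y c}) = even (card {c\<in>vec r. z c})" for y z
    using even_card_xor[of "vec r" y z] by (simp add: vadd_def)
  have sum: "vsum {c\<in>vec r. vadd y z c}
      = vadd (vsum {c\<in>vec r. y c}) (vsum {c\<in>vec r. z c})" for y z
    using vsum_xor[of "vec r" y z] by (simp add: vadd_def)
  have "x \<in> (\<lambda>h. vadd (vadd h (unitv a)) (unitv b)) ` Hcode r \<longleftrightarrow> vadd x ?u \<in> Hcode r"
  proof
    assume "x \<in> (\<lambda>h. vadd (vadd h (unitv a)) (unitv b)) ` Hcode r"
    then obtain h where "h \<in> Hcode r" "x = vadd h ?u"
      by (auto simp: vadd_assoc)
    then show "vadd x ?u \<in> Hcode r"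
      by (simp add: vadd_assoc[of h])
  next
    assume "vadd x ?u \<in> Hcode r"
    moreover have "x = vadd (vadd (vadd x ?u) (unitv a)) (unitv b)"
      by (auto simp: vadd_def fun_eq_iff)
    ultimately show "x \<in> (\<lambda>h. vadd (vadd h (unitv a)) (unitv b)) ` Hcode r"
      by blast
  qed
  moreover have "vadd x ?u \<in> words (vec r) \<longleftrightarrow> x \<in> words (vec r)"
    using vadd_in_words[OF _ uw] by (metis vadd_cancel vadd_commute)
  moreover have "even (card {c\<in>vec r. vadd x ?u c}) \<longleftrightarrow> even (card {c\<in>vec r. x c})"
    using assms by (simp add: par s)
  moreover have "vsum {c\<in>vec r. vadd x ?u c} = vzero \<longleftrightarrow> vsum {c\<in>vec r. x c} = vadd a b"
    using assms by (simp add: sum s vzero_def vadd_eq_zero_iff)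
  ultimately show ?thesis
    by (auto simp: Hcode_def)
qed

lemma concat_in_words: "concat x y \<in> words (I <+> J) \<longleftrightarrow> x \<in> words I \<and> y \<in> words J"
  by (auto simp: words_def concat_def split: sum.splits)

text \<open>As \<open>\<sigma>\<close> fixes zero, the cosets indexed by \<open>a\<close> prescribe
  the sums \<open>a\<close> on the left and \<open>\<sigma> a\<close> on the right. The union over
  \<open>a\<close> thus puts the pair of sums on the graph of \<open>\<sigma>\<close>.\<close>

lemma mem_Scode_iff:
  assumes "\<And>a. a \<in> vec r \<Longrightarrow> \<sigma> a \<in> vec r" "\<sigma> vzero = vzero"
  shows "z \<in> Scode r \<sigma> \<longleftrightarrow> z \<in> words (Scoords r)
    \<and> even (card (lsupp r z)) \<and> even (card (rsupp r z))
    \<and> vsum (rsupp r z) = \<sigma> (vsum (lsupp r z))"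
proof -
  have z: "z = concat (z \<circ> Inl) (z \<circ> Inr)"
    by (auto simp: concat_def fun_eq_iff split: sum.splits)
  have c: "concat x y \<circ> Inl = x" "concat x y \<circ> Inr = y" for x y :: "'a \<Rightarrow> bool"
    by (auto simp: concat_def)
  have "z \<in> Scode r \<sigma> \<longleftrightarrow> (\<exists>a\<in>vec r.
      z \<circ> Inl \<in> (\<lambda>h. vadd (vadd h (unitv a)) (unitv vzero)) ` Hcode r \<and>
      z \<circ> Inr \<in> (\<lambda>h. vadd (vadd h (unitv (\<sigma> a))) (unitv (\<sigma> vzero))) ` Hcode r)"
    unfolding Scode_def using z c by fast
  also have "\<dots> \<longleftrightarrow> (\<exists>a\<in>vec r.
      z \<circ> Inl \<in> words (vec r) \<and> even (card (lsupp r z)) \<and> vsum (lsupp r z) = a \<and>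
      z \<circ> Inr \<in> words (vec r) \<and> even (card (rsupp r z)) \<and> vsum (rsupp r z) = \<sigma> a)"
    using assms by (auto simp: mem_coset_Hcode lsupp_def rsupp_def vzero_def vec_def)
  also have "\<dots> \<longleftrightarrow> z \<circ> Inl \<in> words (vec r) \<and> z \<circ> Inr \<in> words (vec r)
    \<and> even (card (lsupp r z)) \<and> even (card (rsupp r z))
    \<and> vsum (rsupp r z) = \<sigma> (vsum (lsupp r z))"
    using vsum_in_vec[OF lsupp_subset] by auto
  finally have "z \<in> Scode r \<sigma> \<longleftrightarrow> z \<circ> Inl \<in> words (vec r) \<and> z \<circ> Inr \<in> words (vec r)
    \<and> even (card (lsupp r z)) \<and> even (card (rsupp r z))
    \<and> vsum (rsupp r z) = \<sigma> (vsum (lsupp r z))" .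
  moreover have "z \<circ> Inl \<in> words (vec r) \<and> z \<circ> Inr \<in> words (vec r) \<longleftrightarrow> z \<in> words (Scoords r)"
    using concat_in_words[of "z \<circ> Inl" "z \<circ> Inr" "vec r" "vec r"] z
    by (simp add: Scoords_def)
  ultimately show ?thesis
    by blast
qed

text \<open>Here \<open>f\<close> and \<open>g\<close> stand for \<open>Inl\<close> or
  \<open>Inr\<close>, chosen independently, so that permutations preserving the halves and
  permutations exchanging them are covered together.\<close>

lemma perm_word_support:
  assumes "bij_betw \<Pi> I I" "bij_betw p A A" "\<And>s. s \<in> A \<Longrightarrow> f s \<in> I \<and> \<Pi> (f s) = g (p s)"
  shows "{b\<in>A. perm_word I \<Pi> z (g b)} = p ` {s\<in>A. z (f s)}"
proof -
  have "perm_word I \<Pi> z (g (p s)) = z (f s)" if "s \<in> A" for s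
    using perm_word_apply[OF assms(1)] assms(3)[OF that] by metis
  then show ?thesis
    using assms(2) by (fastforce simp: bij_betw_def)
qed

lemma bij_betw_affine:
  assumes "inj_on M (vec r)" "\<And>s. s \<in> vec r \<Longrightarrow> M s \<in> vec r" "b \<in> vec r"
  shows "bij_betw (\<lambda>s. vadd (M s) b) (vec r) (vec r)"
proof -
  have "inj_on (\<lambda>s. vadd (M s) b) (vec r)"
    using assms(1) by (auto simp: inj_on_def)
  moreover have "(\<lambda>s. vadd (M s) b) ` vec r \<subseteq> vec r"
    using assms by (auto intro: vadd_in_vec)
  ultimately show ?thesis
    by (simp add: bij_betw_def endo_inj_surj)
qed

lemma bij_betw_case_sum:
  assumes "bij_betw p A A" "bij_betw q A A"
  shows "bij_betw (case_sum (\<lambda>s. Inl (p s)) (\<lambda>s. Inr (q s))) (A <+> A) (A <+> A)" (is "bij_betw ?f _ _")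
    and "bij_betw (case_sum (\<lambda>s. Inr (p s)) (\<lambda>s. Inl (q s))) (A <+> A) (A <+> A)" (is "bij_betw ?g _ _")
proof -
  have p: "inj_on p A" "p ` A = A" and q: "inj_on q A" "q ` A = A"
    using assms by (auto simp: bij_betw_def)
  have "?f ` (A <+> A) = Inl ` p ` A \<union> Inr ` q ` A"
    unfolding Plus_def image_Un image_image sum.case ..
  then have "?f ` (A <+> A) = A <+> A"
    unfolding p q Plus_def .
  moreover have "inj_on ?f (A <+> A)"
    by (rule inj_onI, elim PlusE) (use p q in \<open>simp_all add: inj_on_eq_iff\<close>)
  ultimately show "bij_betw ?f (A <+> A) (A <+> A)"
    by (simp add: bij_betw_def)
  have "?g ` (A <+> A) = Inr ` p ` A \<union> Inl ` q ` A"
    unfolding Plus_def image_Un image_image sum.case ..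
  then have "?g ` (A <+> A) = A <+> A"
    unfolding p q Plus_def by blast
  moreover have "inj_on ?g (A <+> A)"
    by (rule inj_onI, elim PlusE) (use p q in \<open>simp_all add: inj_on_eq_iff\<close>)
  ultimately show "bij_betw ?g (A <+> A) (A <+> A)"
    by (simp add: bij_betw_def)
qed

text \<open>Pairing a nonzero \<open>s\<close> with the zero vector makes the support even without
  changing its sum. This supplies code words with prescribed sums on the halves.\<close>

lemma even_set_with_sum:
  assumes "s \<in> vec r"
  obtains A where "A \<subseteq> vec r" "even (card A)" "vsum A = s"
proof (cases "s = vzero")
  case True
  then show thesis
    using that[of "{}"] by (simp add: vzero_def)
next
  case False
  then show thesis
    using that[of "{s, vzero}"] assms by (simp add: vsum_insert)
qed

section \<open>Involutions normalising a regular group of affine maps\<close>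

text \<open>The maps \<open>s \<mapsto> L a s + a\<close> are meant to form a regular group of affine permutations of
  \<open>F\<^sup>r\<close>, of which \<open>\<sigma>\<close> induces an involutive automorphism.\<close>

locale affine_involution =
  fixes r :: nat and \<sigma> :: "(nat \<Rightarrow> bool) \<Rightarrow> (nat \<Rightarrow> bool)"
    and L :: "(nat \<Rightarrow> bool) \<Rightarrow> (nat \<Rightarrow> bool) \<Rightarrow> (nat \<Rightarrow> bool)"
  assumes sigma_in: "a \<in> vec r \<Longrightarrow> \<sigma> a \<in> vec r"
    and sigma_zero: "\<sigma> vzero = vzero"
    and sigma_sigma: "a \<in> vec r \<Longrightarrow> \<sigma> (\<sigma> a) = a"
    and L_in: "a \<in> vec r \<Longrightarrow> s \<in> vec r \<Longrightarrow> L a s \<in> vec r"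
    and L_additive: "a \<in> vec r \<Longrightarrow> additive_on r (L a)"
    and L_inj: "a \<in> vec r \<Longrightarrow> inj_on (L a) (vec r)"
    and sigma_affine:
      "a \<in> vec r \<Longrightarrow> s \<in> vec r \<Longrightarrow> \<sigma> (vadd (L a s) a) = vadd (L (\<sigma> a) (\<sigma> s)) (\<sigma> a)"
    and no_linear_structure:
      "a \<in> vec r \<Longrightarrow> a \<noteq> vzero \<Longrightarrow> \<exists>s\<in>vec r. \<sigma> (vadd s a) \<noteq> vadd (\<sigma> s) (\<sigma> a)"
begin

section \<open>Minimum distance and perfectness\<close>

lemma mem_Scode:
  "z \<in> Scode r \<sigma> \<longleftrightarrow> z \<in> words (Scoords r)
    \<and> even (card (lsupp r z)) \<and> even (card (rsupp r z))
    \<and> vsum (rsupp r z) = \<sigma> (vsum (lsupp r z))"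
  using sigma_in sigma_zero by (rule mem_Scode_iff)

lemma Scode_subset_words: "Scode r \<sigma> \<subseteq> words (Scoords r)"
  using mem_Scode by blast

lemma finite_Scode: "finite (Scode r \<sigma>)"
  using finite_subset[OF Scode_subset_words] finite_words_and_card[OF finite_Scoords] by blast

lemma sigma_inj: "a \<in> vec r \<Longrightarrow> b \<in> vec r \<Longrightarrow> \<sigma> a = \<sigma> b \<Longrightarrow> a = b"
  by (metis sigma_sigma)

lemma bij_sigma: "bij_betw \<sigma> (vec r) (vec r)"
  by (rule bij_betw_byWitness[where f' = \<sigma>]) (auto simp: sigma_sigma sigma_in)

text \<open>Since \<open>\<sigma>\<close> is injective, the difference of two code words has sum
  zero in both halves or in neither. If one half of it is empty, the other has sum zero and even
  nonzero weight, which cannot be 2; otherwise both halves have weight at least 2.\<close>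

lemma Scode_distance:
  assumes c: "c \<in> Scode r \<sigma>" and d: "d \<in> Scode r \<sigma>" and "c \<noteq> d"
  shows "hdist (Scoords r) c d \<ge> 4"
proof -
  let ?A = "lsupp r (vadd c d)" and ?B = "rsupp r (vadd c d)"
  have even: "even (card ?A)" "even (card ?B)"
    using c d by (simp_all add: mem_Scode lsupp_vadd rsupp_vadd)
  have "vsum ?A = (\<lambda>_. False) \<longleftrightarrow> vsum (lsupp r c) = vsum (lsupp r d)"
    by (simp add: lsupp_vadd vadd_eq_zero_iff)
  also have "\<dots> \<longleftrightarrow> vsum (rsupp r c) = vsum (rsupp r d)"
    using c d sigma_inj[of "vsum (lsupp r c)" "vsum (lsupp r d)"]
    by (auto simp: mem_Scode vsum_in_vec)
  also have "\<dots> \<longleftrightarrow> vsum ?B = (\<lambda>_. False)"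
    by (simp add: rsupp_vadd vadd_eq_zero_iff)
  finally have sums: "vsum ?A = (\<lambda>_. False) \<longleftrightarrow> vsum ?B = (\<lambda>_. False)" .
  have ne: "\<not> (?A = {} \<and> ?B = {})"
  proof
    assume "?A = {} \<and> ?B = {}"
    then have "lsupp r c = lsupp r d" "rsupp r c = rsupp r d"
      by (auto simp: lsupp_def rsupp_def vadd_def)
    then show False
      using Scoords_word_eqI c d \<open>c \<noteq> d\<close> Scode_subset_words by blast
  qed
  have small: "card X = 0 \<or> card X = 2 \<or> card X \<ge> 4" if "even (card X)" for X :: "(nat \<Rightarrow> bool) set"
    using that by presburger
  have "card ?A + card ?B \<ge> 4"
  proof (cases "?A = {} \<or> ?B = {}")
    case True
    then have "vsum ?A = (\<lambda>_. False)" "vsum ?B = (\<lambda>_. False)"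
      using sums by auto
    then have "card ?A \<noteq> 2" "card ?B \<noteq> 2"
      using vsum_card_two_nonzero by blast+
    moreover have "card ?A \<noteq> 0 \<or> card ?B \<noteq> 0"
      using ne by simp
    ultimately show ?thesis
      using small[OF even(1)] small[OF even(2)] by linarith
  next
    case False
    then have "card ?A \<noteq> 0" "card ?B \<noteq> 0"
      by simp_all
    then show ?thesis
      using small[OF even(1)] small[OF even(2)] by linarith
  qed
  then show ?thesis
    by (simp add: hdist_Scoords)
qed

text \<open>A word of odd weight has odd weight in exactly one half, and flipping a single coordinate
  there, determined by the sums over both halves, yields a code word.\<close>

lemma Scode_flip_bij:
  "bij_betw (\<lambda>(c, i). vadd c (\<lambda>j. j = i)) (Scode r \<sigma> \<times> Scoords r)
    {z \<in> words (Scoords r). odd (card {i\<in>Scoords r. z i})}"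
proof -
  let ?e = "\<lambda>i j. j = i"
  let ?f = "\<lambda>(c, i). vadd c (?e i)"
  have l: "lsupp r (?e (Inl a)) = {a}" "rsupp r (?e (Inl a)) = {}"
    "lsupp r (?e (Inr a)) = {}" "rsupp r (?e (Inr a)) = {a}" if "a \<in> vec r" for a
    using that by (auto simp: lsupp_def rsupp_def)
  have e: "?e i \<in> words (Scoords r)" if "i \<in> Scoords r" for i
    using that by (auto simp: words_def)
  \<comment> \<open>Two code words with a common flipped word would be at distance at most
    2.\<close>
  have inj: "inj_on ?f (Scode r \<sigma> \<times> Scoords r)"
  proof (rule inj_onI, clarify)
    fix c i d j
    assume c: "c \<in> Scode r \<sigma>" and d: "d \<in> Scode r \<sigma>"
      and eq: "vadd c (?e i) = vadd d (?e j)"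
    have "c k = d k" if "k \<notin> {i, j}" for k
      using fun_cong[OF eq, of k] that by (simp add: vadd_def)
    then have "{k \<in> Scoords r. c k \<noteq> d k} \<subseteq> {i, j}"
      by blast
    then have "hdist (Scoords r) c d \<le> card {i, j}"
      unfolding hdist_def by (intro card_mono) auto
    also have "\<dots> < 4"
      by (simp add: card_insert_if)
    finally have "c = d"
      using Scode_distance[OF c d] by force
    moreover from this eq have "?e i = ?e j"
      by simp
    from fun_cong[OF this, of i] have "i = j"
      by simp
    ultimately show "c = d \<and> i = j"
      by simp
  qed
  have surj: "z \<in> ?f ` (Scode r \<sigma> \<times> Scoords r)"
    if z: "z \<in> words (Scoords r)" "odd (card {i\<in>Scoords r. z i})" for z
  proof -
    let ?a = "vsum (lsupp r z)" and ?b = "vsum (rsupp r z)"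
    have ab: "?a \<in> vec r" "?b \<in> vec r"
      by (simp_all add: vsum_in_vec)
    \<comment> \<open>If the left half is odd, its sum \<open>?a\<close> must become
      \<open>\<sigma> ?b\<close>, because \<open>\<sigma>\<close> sends that back to
      \<open>?b\<close>; the coordinate to flip is their difference. If the right half is odd,
      \<open>?b\<close> must become \<open>\<sigma> ?a\<close>.\<close>
    have "\<exists>i\<in>Scoords r. vadd z (?e i) \<in> Scode r \<sigma>"
    proof (cases "odd (card (lsupp r z))")
      case True
      then have "even (card (rsupp r z))"
        using z(2) by (simp add: card_Scoords_filter)
      moreover have "vadd ?a (\<sigma> ?b) \<in> vec r"
        using ab by (simp add: vadd_in_vec sigma_in)
      ultimately show ?thesis
        using True z(1) e ab
        by (intro bexI[of _ "Inl (vadd ?a (\<sigma> ?b))"])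
          (simp_all add: mem_Scode lsupp_vadd rsupp_vadd l sigma_sigma vadd_in_words)
    next
      case False
      then have "odd (card (rsupp r z))"
        using z(2) by (simp add: card_Scoords_filter)
      moreover have "vadd ?b (\<sigma> ?a) \<in> vec r"
        using ab by (simp add: vadd_in_vec sigma_in)
      ultimately show ?thesis
        using False z(1) e ab
        by (intro bexI[of _ "Inr (vadd ?b (\<sigma> ?a))"])
          (simp_all add: mem_Scode lsupp_vadd rsupp_vadd l vadd_in_words)
    qed
    then obtain i where i: "i \<in> Scoords r" "vadd z (?e i) \<in> Scode r \<sigma>"
      by blast
    moreover have "z = vadd (vadd z (?e i)) (?e i)"
      by (simp add: vadd_assoc)
    ultimately show ?thesis
      by (intro image_eqI[of _ _ "(vadd z (?e i), i)"]) auto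
  qed
  have "vadd c (?e i) \<in> words (Scoords r) \<and> odd (card {k\<in>Scoords r. vadd c (?e i) k})"
    if "c \<in> Scode r \<sigma>" "i \<in> Scoords r" for c i
  proof
    show "vadd c (?e i) \<in> words (Scoords r)"
      using that e Scode_subset_words by (auto intro: vadd_in_words)
    show "odd (card {k\<in>Scoords r. vadd c (?e i) k})"
      using that by (cases i) (auto simp: card_Scoords_filter lsupp_vadd rsupp_vadd mem_Scode l)
  qed
  then have "?f ` (Scode r \<sigma> \<times> Scoords r)
      \<subseteq> {z \<in> words (Scoords r). odd (card {i\<in>Scoords r. z i})}"
    by auto
  then show ?thesis
    unfolding bij_betw_def using inj surj by blast
qed

lemma ext_perfect_Scode: "ext_perfect (Scoords r) (Scode r \<sigma>)"
proof -
  have "Scoords r \<noteq> {}"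
    using card_Scoords[of r] by auto
  then have "card (Scode r \<sigma>) * card (Scoords r) = 2 ^ (card (Scoords r) - 1)"
    using bij_betw_same_card[OF Scode_flip_bij] card_odd_words[OF finite_Scoords]
    by (simp add: card_cartesian_product)
  moreover have "card (Scoords r) \<ge> 2"
    by (simp add: card_Scoords)
  ultimately show ?thesis
    using Scode_distance Scode_subset_words by (simp add: ext_perfect_def)
qed

section \<open>Automorphisms of the code\<close>

lemma Scode_AutI:
  assumes "c \<in> Scode r \<sigma>" "bij_betw \<Pi> (Scoords r) (Scoords r)"
    and "\<And>z. z \<in> Scode r \<sigma> \<Longrightarrow> vadd c (perm_word (Scoords r) \<Pi> z) \<in> Scode r \<sigma>"
  shows "(c, \<Pi>) \<in> Aut (Scoords r) (Scode r \<sigma>)"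
proof -
  have "inj_on (\<lambda>z. vadd c (perm_word (Scoords r) \<Pi> z)) (Scode r \<sigma>)"
    using inj_on_perm_word[OF assms(2)] Scode_subset_words by (rule inj_on_subset)
  then have "(\<lambda>z. vadd c (perm_word (Scoords r) \<Pi> z)) ` Scode r \<sigma> = Scode r \<sigma>"
    using assms(3) by (intro endo_inj_surj finite_Scode) auto
  then show ?thesis
    using assms(1,2) Scode_subset_words by (auto simp: Aut_def)
qed

text \<open>Let \<open>a\<close> be the left sum of \<open>c\<close>. Applying \<open>L a\<close> on
  the left and \<open>L (\<sigma> a)\<close> on the right and then adding \<open>c\<close> turns
  sums \<open>(s, \<sigma> s)\<close> into
  \<open>(L a s + a, L (\<sigma> a) (\<sigma> s) + \<sigma> a)\<close>, again on the graph of
  \<open>\<sigma>\<close> by \<open>sigma_affine\<close>. A translation by \<open>b\<close> leaves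
  sums over even supports unchanged and is free to send the coordinate zero of the left half to
  \<open>i\<close>.\<close>

lemma Scode_Aut_to_coordinate:
  assumes c: "c \<in> Scode r \<sigma>" and i: "i \<in> Scoords r"
  shows "\<exists>\<Pi>. \<Pi> (Inl vzero) = i \<and> (c, \<Pi>) \<in> Aut (Scoords r) (Scode r \<sigma>)"
proof -
  let ?I = "Scoords r"
  define a where "a = vsum (lsupp r c)"
  have a: "a \<in> vec r" "\<sigma> a \<in> vec r"
    by (simp_all add: a_def vsum_in_vec sigma_in)
  have cr: "vsum (rsupp r c) = \<sigma> a" and ce: "even (card (lsupp r c))" "even (card (rsupp r c))"
    and cw: "c \<in> words ?I"
    using c by (simp_all add: mem_Scode a_def)
  have L0: "L d vzero = (\<lambda>_. False)" if "d \<in> vec r" for d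
    using additive_on_zero[OF L_additive[OF that]] by (simp add: vzero_def)
  have bij: "bij_betw (\<lambda>s. vadd (L d s) b) (vec r) (vec r)" if "d \<in> vec r" "b \<in> vec r" for d b
    using that by (intro bij_betw_affine L_inj L_in)
  have sum: "vsum ((\<lambda>s. vadd (L d s) b) ` A) = L d (vsum A)"
    if "d \<in> vec r" "A \<subseteq> vec r" "even (card A)" for A d b
    using vsum_affine_image[OF L_additive L_inj, OF that(1) that(1) _ that(2), of b] that
      finite_subset[OF that(2)] by simp
  have cd: "card ((\<lambda>s. vadd (L d s) b) ` A) = card A" if "d \<in> vec r" "b \<in> vec r" "A \<subseteq> vec r" for A d b
    using bij[OF that(1,2)] that(3) by (meson bij_betw_def card_image inj_on_subset)
  consider b where "b \<in> vec r" "i = Inl b" | b where "b \<in> vec r" "i = Inr b"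
    using i by (auto simp: Scoords_def)
  then show ?thesis
  proof cases
    case (1 b)
    \<comment> \<open>The zero translation in \<open>q\<close> gives both halves the affine shape to
      which \<open>bij\<close>, \<open>sum\<close> and \<open>cd\<close> apply.\<close>
    define p q where "p = (\<lambda>s. vadd (L a s) b)" and "q = (\<lambda>s. vadd (L (\<sigma> a) s) vzero)"
    define \<Pi> where "\<Pi> = case_sum (\<lambda>s. Inl (p s)) (\<lambda>s. Inr (q s))"
    have p: "bij_betw p (vec r) (vec r)" and q: "bij_betw q (vec r) (vec r)"
      unfolding p_def q_def by (rule bij; use a 1 in simp)+
    have \<Pi>: "bij_betw \<Pi> ?I ?I"
      unfolding \<Pi>_def Scoords_def by (rule bij_betw_case_sum(1)[OF p q])
    have "vadd c (perm_word ?I \<Pi> z) \<in> Scode r \<sigma>" if z: "z \<in> Scode r \<sigma>" for z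
    proof -
      let ?w = "perm_word ?I \<Pi> z"
      have w: "lsupp r ?w = p ` lsupp r z" "rsupp r ?w = q ` rsupp r z"
        unfolding lsupp_def rsupp_def
        by (rule perm_word_support[OF \<Pi>]; use p q in \<open>simp add: \<Pi>_def\<close>)+
      have ze: "even (card (lsupp r z))" "even (card (rsupp r z))"
        and zs: "vsum (rsupp r z) = \<sigma> (vsum (lsupp r z))"
        using z by (simp_all add: mem_Scode)
      have "vsum (lsupp r ?w) = L a (vsum (lsupp r z))"
        "vsum (rsupp r ?w) = L (\<sigma> a) (\<sigma> (vsum (lsupp r z)))"
        using sum[OF a(1) lsupp_subset ze(1), of b] sum[OF a(2) rsupp_subset ze(2), of vzero]
        unfolding w p_def q_def zs by simp_all
      moreover have "even (card (lsupp r ?w))" "even (card (rsupp r ?w))"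
        using cd[OF a(1) 1(1) lsupp_subset] cd[OF a(2) vzero_in_vec rsupp_subset] ze
        unfolding w p_def q_def by metis+
      ultimately show ?thesis
        using cw ce cr a_def[symmetric] perm_word_in_words[OF \<Pi>]
          sigma_affine[OF a(1), of "vsum (lsupp r z)"]
        by (simp add: mem_Scode vadd_in_words lsupp_vadd rsupp_vadd vsum_in_vec vadd_commute)
    qed
    then have "(c, \<Pi>) \<in> Aut ?I (Scode r \<sigma>)"
      by (rule Scode_AutI[OF c \<Pi>])
    moreover have "\<Pi> (Inl vzero) = i"
      using a 1 by (simp add: \<Pi>_def p_def L0)
    ultimately show ?thesis
      by blast
  next
    case (2 b)
    \<comment> \<open>With the halves exchanged, \<open>L (\<sigma> a)\<close> acts on the former
      left half. The new left sum is \<open>L a (\<sigma> s) + a\<close>, and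
      \<open>sigma_affine\<close> at \<open>\<sigma> s\<close> together with
      \<open>\<sigma> (\<sigma> s) = s\<close> gives the right one.\<close>
    define p q where "p = (\<lambda>s. vadd (L (\<sigma> a) s) b)" and "q = (\<lambda>s. vadd (L a s) vzero)"
    define \<Pi> where "\<Pi> = case_sum (\<lambda>s. Inr (p s)) (\<lambda>s. Inl (q s))"
    have p: "bij_betw p (vec r) (vec r)" and q: "bij_betw q (vec r) (vec r)"
      unfolding p_def q_def by (rule bij; use a 2 in simp)+
    have \<Pi>: "bij_betw \<Pi> ?I ?I"
      unfolding \<Pi>_def Scoords_def by (rule bij_betw_case_sum(2)[OF p q])
    have "vadd c (perm_word ?I \<Pi> z) \<in> Scode r \<sigma>" if z: "z \<in> Scode r \<sigma>" for z
    proof -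
      let ?w = "perm_word ?I \<Pi> z"
      have w: "lsupp r ?w = q ` rsupp r z" "rsupp r ?w = p ` lsupp r z"
        unfolding lsupp_def rsupp_def
        by (rule perm_word_support[OF \<Pi>]; use p q in \<open>simp add: \<Pi>_def\<close>)+
      have ze: "even (card (lsupp r z))" "even (card (rsupp r z))"
        and zs: "vsum (rsupp r z) = \<sigma> (vsum (lsupp r z))"
        using z by (simp_all add: mem_Scode)
      have "vsum (lsupp r ?w) = L a (\<sigma> (vsum (lsupp r z)))"
        "vsum (rsupp r ?w) = L (\<sigma> a) (vsum (lsupp r z))"
        using sum[OF a(1) rsupp_subset ze(2), of vzero] sum[OF a(2) lsupp_subset ze(1), of b]
        unfolding w p_def q_def zs by simp_all
      moreover have "even (card (lsupp r ?w))" "even (card (rsupp r ?w))"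
        using cd[OF a(1) vzero_in_vec rsupp_subset] cd[OF a(2) 2(1) lsupp_subset] ze
        unfolding w p_def q_def by metis+
      ultimately show ?thesis
        using cw ce cr a_def[symmetric] perm_word_in_words[OF \<Pi>]
          sigma_affine[OF a(1), of "\<sigma> (vsum (lsupp r z))"]
        by (simp add: mem_Scode vadd_in_words lsupp_vadd rsupp_vadd vsum_in_vec vadd_commute
            sigma_in sigma_sigma)
    qed
    then have "(c, \<Pi>) \<in> Aut ?I (Scode r \<sigma>)"
      by (rule Scode_AutI[OF c \<Pi>])
    moreover have "\<Pi> (Inl vzero) = i"
      using a 2 by (simp add: \<Pi>_def p_def L0)
    ultimately show ?thesis
      by blast
  qed
qed

lemma neighbor_transitive_Scode: "neighbor_transitive (Scoords r) (Scode r \<sigma>)"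
  by (rule neighbor_transitiveI[where j = "Inl vzero"])
    (use Scode_subset_words Scode_Aut_to_coordinate in auto)

section \<open>The kernel of the code and Mollard codes\<close>

text \<open>The zero word shows that \<open>k\<close> itself is a code word. Adding \<open>k\<close>
  to a code word with sums \<open>s\<close> and \<open>\<sigma> s\<close> then gives
  \<open>\<sigma> (s + a) = \<sigma> s + \<sigma> a\<close> for the left sum \<open>a\<close> of
  \<open>k\<close> and every \<open>s\<close>, so \<open>no_linear_structure\<close> forces
  \<open>a\<close> to vanish.\<close>

lemma Scode_kernel_lsum:
  assumes k: "k \<in> words (Scoords r)" and ker: "\<And>z. z \<in> Scode r \<sigma> \<Longrightarrow> vadd k z \<in> Scode r \<sigma>"
  shows "even (card (lsupp r k))" "vsum (lsupp r k) = (\<lambda>_. False)"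
proof -
  have "(\<lambda>_. False) \<in> Scode r \<sigma>"
    using sigma_zero by (simp add: mem_Scode words_def lsupp_def rsupp_def vzero_def)
  from ker[OF this] have kS: "k \<in> Scode r \<sigma>"
    by simp
  then show "even (card (lsupp r k))"
    by (simp add: mem_Scode)
  let ?a = "vsum (lsupp r k)"
  have "\<sigma> (vadd s ?a) = vadd (\<sigma> s) (\<sigma> ?a)" if s: "s \<in> vec r" for s
  proof -
    obtain A where A: "A \<subseteq> vec r" "even (card A)" "vsum A = s"
      using even_set_with_sum[OF s] .
    obtain B where B: "B \<subseteq> vec r" "even (card B)" "vsum B = \<sigma> s"
      using even_set_with_sum[OF sigma_in[OF s]] .
    let ?z = "case_sum (\<lambda>a. a \<in> A) (\<lambda>b. b \<in> B)"
    have z: "lsupp r ?z = A" "rsupp r ?z = B"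
      using A(1) B(1) by (auto simp: lsupp_def rsupp_def)
    have "?z \<in> words (Scoords r)"
      using A(1) B(1) by (auto simp: words_def Scoords_def split: sum.splits)
    then have "?z \<in> Scode r \<sigma>"
      using A B by (simp add: mem_Scode z)
    from ker[OF this] kS show ?thesis
      using A B by (simp add: mem_Scode lsupp_vadd rsupp_vadd z vadd_commute)
  qed
  then have "?a = vzero"
    using no_linear_structure[of ?a] by (auto simp: vsum_in_vec)
  then show "?a = (\<lambda>_. False)"
    by (simp add: vzero_def)
qed

text \<open>The left weight is even and, as the left sum is zero, different from 2; so it is 0 or
  4.\<close>

lemma Scode_kernel_weight_4:
  assumes k: "k \<in> words (Scoords r)" and ker: "\<And>z. z \<in> Scode r \<sigma> \<Longrightarrow> vadd k z \<in> Scode r \<sigma>"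
    and four: "card {i\<in>Scoords r. k i} = 4"
  shows "lsupp r k = {} \<or> rsupp r k = {}"
proof -
  have sums: "even (card (lsupp r k))" "vsum (lsupp r k) = (\<lambda>_. False)"
    using Scode_kernel_lsum[OF k] ker by blast+
  have small: "m = 0 \<or> n = 0" if "m \<noteq> 2" "m + n = 4" "even m" for m n :: nat
    using that by presburger
  have "card (lsupp r k) \<noteq> 2"
    using sums(2) vsum_card_two_nonzero by blast
  moreover have "card (lsupp r k) + card (rsupp r k) = 4"
    using four by (simp add: card_Scoords_filter)
  ultimately have "card (lsupp r k) = 0 \<or> card (rsupp r k) = 0"
    using sums(1) by (rule small)
  then show ?thesis
    by simp
qed

end

text \<open>A rectangle meets every row and every column in 0 or 2 cells, so adding it changes
  neither projection, and hence not the value of \<open>\<phi>\<close> either.\<close>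

lemma mollard_add_rectangle:
  assumes z: "z \<in> mollard t m C D \<phi>" and R: "i < t" "i' < t" "i \<noteq> i'" "s < m" "s' < m" "s \<noteq> s'"
  shows "vadd (\<lambda>p. p \<in> {i, i'} \<times> {s, s'}) z \<in> mollard t m C D \<phi>"
proof -
  let ?Q = "\<lambda>p. p \<in> {i, i'} \<times> {s, s'}"
  have "{q\<in>{..<m}. ?Q (j, q)} = (if j \<in> {i, i'} then {s, s'} else {})" for j
    using R by auto
  then have Q1: "even (card {q\<in>{..<m}. ?Q (j, q)})" for j
    using R by simp
  have "{j\<in>{..<t}. ?Q (j, q)} = (if q \<in> {s, s'} then {i, i'} else {})" for q
    using R by auto
  then have Q2: "even (card {j\<in>{..<t}. ?Q (j, q)})" for q
    using R by simp
  have "odd (card {q\<in>{..<m}. vadd ?Q z (j, q)}) \<longleftrightarrow> odd (card {q\<in>{..<m}. z (j, q)})" for j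
    using even_card_xor[of "{..<m}" "\<lambda>q. ?Q (j, q)" "\<lambda>q. z (j, q)"] Q1[of j]
    by (simp only: vadd_def finite_lessThan) simp
  then have m1: "mp1 t m (vadd ?Q z) = mp1 t m z"
    by (simp only: mp1_def)
  have "odd (card {j\<in>{..<t}. vadd ?Q z (j, q)}) \<longleftrightarrow> odd (card {j\<in>{..<t}. z (j, q)})" for q
    using even_card_xor[of "{..<t}" "\<lambda>j. ?Q (j, q)" "\<lambda>j. z (j, q)"] Q2[of q]
    by (simp only: vadd_def finite_lessThan) simp
  then have m2: "mp2 t m (vadd ?Q z) = mp2 t m z"
    by (simp only: mp2_def)
  have "?Q \<in> words ({..<t} \<times> {..<m})"
    using R by (auto simp: words_def)
  then show ?thesis
    using z m1 m2 by (simp add: mollard_def vadd_in_words)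
qed

text \<open>Rectangles with a corner at \<open>(0, 0)\<close> pull back along an isomorphism to
  kernel words of weight 4, each inside one half. Every cell shares such a rectangle with
  \<open>(0, 0)\<close>, so all coordinates would lie in one half.\<close>

lemma (in affine_involution) non_mollard_Scode: "non_mollard (Scoords r) (Scode r \<sigma>)"
  unfolding non_mollard_def
proof
  let ?I = "Scoords r"
  assume "\<exists>t m C D \<phi>. ext_perfect {..<t} C \<and> ext_perfect {..<m} D
    \<and> (\<forall>c\<in>C. \<phi> c \<in> words {..<m}) \<and> code_iso ?I (Scode r \<sigma>) ({..<t} \<times> {..<m}) (mollard t m C D \<phi>)"
  then obtain t m C D \<phi> x \<pi> where t: "t \<ge> 2" and m: "m \<ge> 2"
    and \<pi>: "bij_betw \<pi> ?I ({..<t} \<times> {..<m})"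
    and M: "mollard t m C D \<phi> = (\<lambda>y. vadd x (perm_word ?I \<pi> y)) ` Scode r \<sigma>"
    by (auto simp: ext_perfect_def code_iso_def)
  have same_side: "isl j \<longleftrightarrow> isl j'"
    if i: "0 < i" "i < t" and s: "0 < s" "s < m" and j: "j \<in> ?I" "j' \<in> ?I"
      and R: "\<pi> j \<in> {0, i} \<times> {0, s}" "\<pi> j' \<in> {0, i} \<times> {0, s}" for i s j j'
  proof -
    let ?Q = "\<lambda>p. p \<in> {0, i} \<times> {0, s}"
    define k where "k = (\<lambda>j. j \<in> ?I \<and> ?Q (\<pi> j))"
    have k: "k \<in> words ?I"
      by (auto simp: words_def k_def)
    have "perm_word ?I \<pi> k = ?Q"
    proof (rule words_eqI[where I = "{..<t} \<times> {..<m}"])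
      show "perm_word ?I \<pi> k \<in> words ({..<t} \<times> {..<m})"
        by (rule perm_word_in_words[OF \<pi>])
      show "?Q \<in> words ({..<t} \<times> {..<m})"
        using i s by (auto simp: words_def)
      fix p assume "p \<in> {..<t} \<times> {..<m}"
      then obtain l where "l \<in> ?I" "p = \<pi> l"
        using \<pi> by (auto simp: bij_betw_def)
      then show "perm_word ?I \<pi> k p = ?Q p"
        using perm_word_apply[OF \<pi>] by (simp add: k_def)
    qed
    moreover have "vadd k z \<in> Scode r \<sigma>" if z: "z \<in> Scode r \<sigma>" and eq: "perm_word ?I \<pi> k = ?Q" for z
    proof -
      \<comment> \<open>Adding the rectangle commutes with the translation by \<open>x\<close>, so
        the isomorphism transports it to adding \<open>k\<close>.\<close>
      have "vadd ?Q (vadd x (perm_word ?I \<pi> z)) \<in> mollard t m C D \<phi>"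
        using mollard_add_rectangle[of _ t m C D \<phi> 0 i 0 s] z M i s by simp
      also have "vadd ?Q (vadd x (perm_word ?I \<pi> z)) = vadd x (perm_word ?I \<pi> (vadd k z))"
        by (simp only: perm_word_vadd eq vadd_left_commute[of ?Q x])
      finally obtain y where y: "y \<in> Scode r \<sigma>"
        "vadd x (perm_word ?I \<pi> (vadd k z)) = vadd x (perm_word ?I \<pi> y)"
        unfolding M by blast
      have "vadd k z \<in> words ?I" "y \<in> words ?I"
        using k z y(1) Scode_subset_words by (auto intro: vadd_in_words)
      then have "vadd k z = y"
        using inj_on_perm_word[OF \<pi>, of x] y(2) unfolding inj_on_def by blast
      then show ?thesis
        using y(1) by simp
    qed
    moreover have "card {j\<in>?I. k j} = 4"
    proof -
      have "inj_on \<pi> {j\<in>?I. k j}"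
        using \<pi> by (auto simp: bij_betw_def inj_on_def)
      then have "card {j\<in>?I. k j} = card (\<pi> ` {j\<in>?I. k j})"
        by (simp add: card_image)
      also have "\<pi> ` {j\<in>?I. k j} = \<pi> ` ?I \<inter> {0, i} \<times> {0, s}"
        by (auto simp: k_def)
      also have "\<dots> = {0, i} \<times> {0, s}"
        using \<pi> i s by (auto simp: bij_betw_def)
      finally show ?thesis
        using i s by (simp add: card_cartesian_product)
    qed
    ultimately have "lsupp r k = {} \<or> rsupp r k = {}"
      using Scode_kernel_weight_4[OF k] by blast
    moreover have "k j" "k j'"
      using j R by (auto simp: k_def)
    ultimately show ?thesis
      using j by (cases j; cases j') (auto simp: lsupp_def rsupp_def Scoords_def)
  qed
  obtain j0 where j0: "j0 \<in> ?I" "\<pi> j0 = (0, 0)"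
  proof -
    have "(0, 0) \<in> \<pi> ` ?I"
      using \<pi> t m by (simp add: bij_betw_def)
    then show thesis
      using that by force
  qed
  have "isl j \<longleftrightarrow> isl j0" if j: "j \<in> ?I" for j
  proof -
    obtain i s where ij: "\<pi> j = (i, s)" "i < t" "s < m"
      using bij_betwE[OF \<pi>] j by (cases "\<pi> j") auto
    show ?thesis
      \<comment> \<open>A cell in row 0 or column 0 would give a degenerate rectangle; index 1
        replaces 0 there and exists because \<open>t\<close> and \<open>m\<close> are at least
        2.\<close>
      by (rule same_side[of "if i = 0 then 1 else i" "if s = 0 then 1 else s"])
        (use j j0 ij t m in auto)
  qed
  from this[of "Inl vzero"] this[of "Inr vzero"] show False
    by simp
qed

section \<open>Direct sums and the two base cases\<close>

definition vjoin :: "nat \<Rightarrow> (nat \<Rightarrow> bool) \<Rightarrow> (nat \<Rightarrow> bool) \<Rightarrow> (nat \<Rightarrow> bool)" where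
  "vjoin p x y = (\<lambda>i. if i < p then x i else y (i - p))"

definition vlow :: "nat \<Rightarrow> (nat \<Rightarrow> bool) \<Rightarrow> (nat \<Rightarrow> bool)" where
  "vlow p a = (\<lambda>i. i < p \<and> a i)"

definition vhigh :: "nat \<Rightarrow> (nat \<Rightarrow> bool) \<Rightarrow> (nat \<Rightarrow> bool)" where
  "vhigh p a = (\<lambda>i. a (i + p))"

lemma vlow_in_vec [simp]: "vlow p a \<in> vec p"
  by (simp add: vlow_def vec_def)

lemma vhigh_in_vec [simp]: "a \<in> vec (p + q) \<Longrightarrow> vhigh p a \<in> vec q"
  by (simp add: vhigh_def vec_def add.commute)

lemma vjoin_in_vec [simp]: "y \<in> vec q \<Longrightarrow> vjoin p x y \<in> vec (p + q)"
  by (auto simp: vjoin_def vec_def)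

lemma vlow_vjoin [simp]: "x \<in> vec p \<Longrightarrow> vlow p (vjoin p x y) = x"
  by (auto simp: vlow_def vjoin_def vec_def fun_eq_iff not_less)

lemma vhigh_vjoin [simp]: "vhigh p (vjoin p x y) = y"
  by (simp add: vhigh_def vjoin_def)

lemma vjoin_vlow_vhigh [simp]: "vjoin p (vlow p a) (vhigh p a) = a"
  by (auto simp: vhigh_def vjoin_def vlow_def fun_eq_iff)

lemma vlow_vadd [simp]: "vlow p (vadd a b) = vadd (vlow p a) (vlow p b)"
  by (auto simp: vlow_def vadd_def fun_eq_iff)

lemma vhigh_vadd [simp]: "vhigh p (vadd a b) = vadd (vhigh p a) (vhigh p b)"
  by (auto simp: vhigh_def vadd_def fun_eq_iff)

lemma vadd_vjoin: "vadd (vjoin p x y) (vjoin p x' y') = vjoin p (vadd x x') (vadd y y')"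
  by (auto simp: vjoin_def vadd_def fun_eq_iff)

lemma vlow_vhigh_vzero [simp]:
  "vlow p vzero = vzero" "vhigh p vzero = vzero" "vjoin p vzero vzero = vzero"
  by (auto simp: vlow_def vhigh_def vjoin_def vzero_def fun_eq_iff)

lemma vjoin_eq_iff:
  assumes "x \<in> vec p" "x' \<in> vec p"
  shows "vjoin p x y = vjoin p x' y' \<longleftrightarrow> x = x' \<and> y = y'"
  using assms by (metis vlow_vjoin vhigh_vjoin)

text \<open>Everything is componentwise. A nonzero \<open>a\<close> has a nonzero component, and a
  vector violating additivity there, padded with zero, violates it for the sum.\<close>

lemma affine_involution_direct_sum:
  assumes "affine_involution p \<sigma>1 L1" "affine_involution q \<sigma>2 L2"
  shows "affine_involution (p + q) (\<lambda>a. vjoin p (\<sigma>1 (vlow p a)) (\<sigma>2 (vhigh p a)))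
    (\<lambda>a s. vjoin p (L1 (vlow p a) (vlow p s)) (L2 (vhigh p a) (vhigh p s)))"
proof -
  interpret A: affine_involution p \<sigma>1 L1
    by fact
  interpret B: affine_involution q \<sigma>2 L2
    by fact
  show ?thesis
  proof
    fix a assume a: "a \<in> vec (p + q)"
    show "vjoin p (\<sigma>1 (vlow p a)) (\<sigma>2 (vhigh p a)) \<in> vec (p + q)"
      using a by (simp add: B.sigma_in)
    show "vjoin p (\<sigma>1 (vlow p (vjoin p (\<sigma>1 (vlow p a)) (\<sigma>2 (vhigh p a)))))
        (\<sigma>2 (vhigh p (vjoin p (\<sigma>1 (vlow p a)) (\<sigma>2 (vhigh p a))))) = a"
      using a by (simp add: A.sigma_in A.sigma_sigma B.sigma_sigma)
    show "additive_on (p + q) (\<lambda>s. vjoin p (L1 (vlow p a) (vlow p s)) (L2 (vhigh p a) (vhigh p s)))"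
      using a A.L_additive[of "vlow p a"] B.L_additive[of "vhigh p a"]
      by (simp add: additive_on_def vadd_vjoin)
    show "inj_on (\<lambda>s. vjoin p (L1 (vlow p a) (vlow p s)) (L2 (vhigh p a) (vhigh p s))) (vec (p + q))"
    proof (rule inj_onI)
      fix s t assume st: "s \<in> vec (p + q)" "t \<in> vec (p + q)"
        and "vjoin p (L1 (vlow p a) (vlow p s)) (L2 (vhigh p a) (vhigh p s))
          = vjoin p (L1 (vlow p a) (vlow p t)) (L2 (vhigh p a) (vhigh p t))"
      then have "L1 (vlow p a) (vlow p s) = L1 (vlow p a) (vlow p t)"
        "L2 (vhigh p a) (vhigh p s) = L2 (vhigh p a) (vhigh p t)"
        using a by (simp_all add: vjoin_eq_iff A.L_in)
      then have "vlow p s = vlow p t" "vhigh p s = vhigh p t"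
        using a st A.L_inj[of "vlow p a"] B.L_inj[of "vhigh p a"] by (auto dest: inj_onD)
      then show "s = t"
        by (metis vjoin_vlow_vhigh)
    qed
    fix s assume s: "s \<in> vec (p + q)"
    show "vjoin p (L1 (vlow p a) (vlow p s)) (L2 (vhigh p a) (vhigh p s)) \<in> vec (p + q)"
      using a s by (simp add: B.L_in)
    show "vjoin p
        (\<sigma>1 (vlow p (vadd (vjoin p (L1 (vlow p a) (vlow p s)) (L2 (vhigh p a) (vhigh p s))) a)))
        (\<sigma>2 (vhigh p (vadd (vjoin p (L1 (vlow p a) (vlow p s)) (L2 (vhigh p a) (vhigh p s))) a)))
      = vadd (vjoin p
          (L1 (vlow p (vjoin p (\<sigma>1 (vlow p a)) (\<sigma>2 (vhigh p a))))
            (vlow p (vjoin p (\<sigma>1 (vlow p s)) (\<sigma>2 (vhigh p s)))))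
          (L2 (vhigh p (vjoin p (\<sigma>1 (vlow p a)) (\<sigma>2 (vhigh p a))))
            (vhigh p (vjoin p (\<sigma>1 (vlow p s)) (\<sigma>2 (vhigh p s))))))
        (vjoin p (\<sigma>1 (vlow p a)) (\<sigma>2 (vhigh p a)))"
      using a s by (simp add: A.L_in A.sigma_in A.sigma_affine B.sigma_affine vadd_vjoin)
  next
    show "vjoin p (\<sigma>1 (vlow p vzero)) (\<sigma>2 (vhigh p vzero)) = vzero"
      by (simp add: A.sigma_zero B.sigma_zero)
  next
    fix a assume a: "a \<in> vec (p + q)" and "a \<noteq> vzero"
    then have "vlow p a \<noteq> vzero \<or> vhigh p a \<noteq> vzero"
      by (metis vjoin_vlow_vhigh vlow_vhigh_vzero(3))
    then show "\<exists>s\<in>vec (p + q). vjoin p (\<sigma>1 (vlow p (vadd s a))) (\<sigma>2 (vhigh p (vadd s a)))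
      \<noteq> vadd (vjoin p (\<sigma>1 (vlow p s)) (\<sigma>2 (vhigh p s))) (vjoin p (\<sigma>1 (vlow p a)) (\<sigma>2 (vhigh p a)))"
    proof
      assume "vlow p a \<noteq> vzero"
      then obtain s where "s \<in> vec p" "\<sigma>1 (vadd s (vlow p a)) \<noteq> vadd (\<sigma>1 s) (\<sigma>1 (vlow p a))"
        using A.no_linear_structure[of "vlow p a"] by auto
      then show ?thesis
        by (intro bexI[of _ "vjoin p s vzero"])
          (simp_all add: vadd_vjoin vjoin_eq_iff A.sigma_in vadd_in_vec)
    next
      assume "vhigh p a \<noteq> vzero"
      then obtain s where "s \<in> vec q" "\<sigma>2 (vadd s (vhigh p a)) \<noteq> vadd (\<sigma>2 s) (\<sigma>2 (vhigh p a))"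
        using B.no_linear_structure[of "vhigh p a"] a by auto
      then show ?thesis
        by (intro bexI[of _ "vjoin p vzero s"])
          (simp_all add: vadd_vjoin vjoin_eq_iff A.sigma_in vadd_in_vec)
    qed
  qed
qed

section \<open>Explicit examples in dimensions 3 and 4\<close>

definition bits :: "bool list \<Rightarrow> nat \<Rightarrow> bool" where
  "bits xs = (\<lambda>i. i < length xs \<and> xs ! i)"

lemma bits_nth:
  "bits (x # xs) 0 = x" "bits (x # y # xs) 1 = y" "bits (x # y # z # xs) 2 = z"
  "bits (x # y # z # w # xs) 3 = w"
  by (simp_all add: bits_def)

lemma bits_in_vec: "length xs = n \<Longrightarrow> bits xs \<in> vec n"
  by (auto simp: bits_def vec_def)

lemma bits_eq_iff:
  assumes "length xs = length ys"
  shows "bits xs = bits ys \<longleftrightarrow> xs = ys"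
proof
  assume eq: "bits xs = bits ys"
  show "xs = ys"
  proof (rule nth_equalityI[OF assms])
    fix i assume "i < length xs"
    then show "xs ! i = ys ! i"
      using fun_cong[OF eq, of i] assms by (simp add: bits_def)
  qed
qed simp

lemma vadd_bits: "length xs = length ys \<Longrightarrow> vadd (bits xs) (bits ys) = bits (map2 (\<noteq>) xs ys)"
  by (auto simp: bits_def vadd_def fun_eq_iff)

lemma vzero_eq_bits: "vzero = bits (replicate n False)"
  by (auto simp: vzero_def bits_def fun_eq_iff)

lemma vec_3_eq_bits:
  assumes "a \<in> vec 3"
  obtains a0 a1 a2 where "a = bits [a0, a1, a2]"
proof
  show "a = bits [a 0, a 1, a 2]"
  proof
    fix i :: nat
    consider "i = 0" | "i = 1" | "i = 2" | "i \<ge> 3"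
      by linarith
    then show "a i = bits [a 0, a 1, a 2] i"
      by cases (use assms in \<open>simp_all add: bits_nth bits_def vec_def\<close>)
  qed
qed

lemma vec_4_eq_bits:
  assumes "a \<in> vec 4"
  obtains a0 a1 a2 a3 where "a = bits [a0, a1, a2, a3]"
proof
  show "a = bits [a 0, a 1, a 2, a 3]"
  proof
    fix i :: nat
    consider "i = 0" | "i = 1" | "i = 2" | "i = 3" | "i \<ge> 4"
      by linarith
    then show "a i = bits [a 0, a 1, a 2, a 3] i"
      by cases (use assms in \<open>simp_all add: bits_nth bits_def vec_def\<close>)
  qed
qed

text \<open>These pairs come from a computer search through the involutive automorphisms of the regular
  2-subgroups of unitriangular affine maps.\<close>

definition sigma3 :: "(nat \<Rightarrow> bool) \<Rightarrow> (nat \<Rightarrow> bool)" where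
  "sigma3 a = bits [a 0, (a 0 \<and> a 1) \<noteq> a 2, (a 1 \<noteq> (a 0 \<and> a 1)) \<noteq> (a 0 \<and> a 2)]"

text \<open>The correction of the last coordinate is the alternating form
  \<open>a0 s1 + a1 s0\<close>; the maps \<open>s \<mapsto> L a s + a\<close> form an elementary
  abelian group.\<close>

definition lin3 :: "(nat \<Rightarrow> bool) \<Rightarrow> (nat \<Rightarrow> bool) \<Rightarrow> (nat \<Rightarrow> bool)" where
  "lin3 a s = bits [s 0, s 1, s 2 \<noteq> ((a 0 \<and> s 1) \<noteq> (a 1 \<and> s 0))]"

lemma affine_involution_3: "affine_involution 3 sigma3 lin3"
proof
  \<comment> \<open>The simplifier turns the index 1 into \<open>Suc 0\<close>, so the second bit is
    supplied for both forms. The main conditions then become propositional statements about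
    bits.\<close>
  note [simp] = sigma3_def lin3_def bits_nth bits_nth(2)[unfolded One_nat_def] bits_eq_iff vadd_bits
  have "sigma3 vzero = bits [False, False, False]"
    by (simp add: vzero_def)
  then show "sigma3 vzero = vzero"
    by (simp add: vzero_eq_bits[of 3] numeral_eq_Suc del: sigma3_def)
  fix a :: "nat \<Rightarrow> bool" assume "a \<in> vec 3"
  then obtain a0 a1 a2 where a: "a = bits [a0, a1, a2]"
    by (rule vec_3_eq_bits)
  show "sigma3 a \<in> vec 3"
    by (simp add: bits_in_vec)
  show "sigma3 (sigma3 a) = a"
    by (auto simp: a)
  show "additive_on 3 (lin3 a)"
    unfolding additive_on_def
  proof (intro ballI)
    fix s t :: "nat \<Rightarrow> bool" assume "s \<in> vec 3" "t \<in> vec 3"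
    then obtain s0 s1 s2 t0 t1 t2 where "s = bits [s0, s1, s2]" "t = bits [t0, t1, t2]"
      by (elim vec_3_eq_bits)
    then show "lin3 a (vadd s t) = vadd (lin3 a s) (lin3 a t)"
      by (simp add: a) argo
  qed
  show "inj_on (lin3 a) (vec 3)"
  proof (rule inj_onI)
    fix s t :: "nat \<Rightarrow> bool" assume "s \<in> vec 3" "t \<in> vec 3" and eq: "lin3 a s = lin3 a t"
    then obtain s0 s1 s2 t0 t1 t2 where "s = bits [s0, s1, s2]" "t = bits [t0, t1, t2]"
      by (elim vec_3_eq_bits)
    with eq show "s = t"
      by (simp add: a) argo
  qed
  show "\<exists>s\<in>vec 3. sigma3 (vadd s a) \<noteq> vadd (sigma3 s) (sigma3 a)" if "a \<noteq> vzero"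
  proof (rule ccontr)
    assume "\<not> ?thesis"
    then have lin: "sigma3 (vadd (bits [s0, s1, s2]) a)
        = vadd (sigma3 (bits [s0, s1, s2])) (sigma3 a)" for s0 s1 s2
      by (simp add: bits_in_vec del: sigma3_def)
    \<comment> \<open>Additivity against the first unit vector forces \<open>a1\<close> and
      \<open>a2\<close> to vanish, against the second \<open>a0\<close>.\<close>
    have "\<not> a0" "\<not> a1" "\<not> a2"
      using lin[of True False False] lin[of False True False] by (auto simp: a)
    then show False
      using that by (simp add: a vzero_eq_bits[of 3] numeral_eq_Suc)
  qed
  fix s :: "nat \<Rightarrow> bool" assume "s \<in> vec 3"
  then obtain s0 s1 s2 where s: "s = bits [s0, s1, s2]"
    by (rule vec_3_eq_bits)
  show "lin3 a s \<in> vec 3"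
    by (simp add: bits_in_vec)
  show "sigma3 (vadd (lin3 a s) a) = vadd (lin3 (sigma3 a) (sigma3 s)) (sigma3 a)"
    by (simp add: a s) argo
qed

definition sigma4 :: "(nat \<Rightarrow> bool) \<Rightarrow> (nat \<Rightarrow> bool)" where
  "sigma4 a = bits [a 2, (a 0 \<and> a 1) \<noteq> a 3, a 0, a 1 \<noteq> (a 2 \<and> ((a 0 \<and> a 1) \<noteq> a 3))]"

text \<open>Here the maps \<open>s \<mapsto> L a s + a\<close> form an abelian group in which
  \<open>a\<close> has the square \<open>(0, a0, 0, a2)\<close>; it is the product of two cyclic
  groups of order 4.\<close>

definition lin4 :: "(nat \<Rightarrow> bool) \<Rightarrow> (nat \<Rightarrow> bool) \<Rightarrow> (nat \<Rightarrow> bool)" where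
  "lin4 a s = bits [s 0, s 1 \<noteq> (a 0 \<and> s 0), s 2,
     (s 3 \<noteq> (a 0 \<and> s 1)) \<noteq> ((a 1 \<and> s 0) \<noteq> (a 2 \<and> s 2))]"

lemma affine_involution_4: "affine_involution 4 sigma4 lin4"
proof
  note [simp] = sigma4_def lin4_def bits_nth bits_nth(2)[unfolded One_nat_def] bits_eq_iff vadd_bits
  have "sigma4 vzero = bits [False, False, False, False]"
    by (simp add: vzero_def)
  then show "sigma4 vzero = vzero"
    by (simp add: vzero_eq_bits[of 4] numeral_eq_Suc del: sigma4_def)
  fix a :: "nat \<Rightarrow> bool" assume "a \<in> vec 4"
  then obtain a0 a1 a2 a3 where a: "a = bits [a0, a1, a2, a3]"
    by (rule vec_4_eq_bits)
  show "sigma4 a \<in> vec 4"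
    by (simp add: bits_in_vec)
  show "sigma4 (sigma4 a) = a"
    by (auto simp: a)
  show "additive_on 4 (lin4 a)"
    unfolding additive_on_def
  proof (intro ballI)
    fix s t :: "nat \<Rightarrow> bool" assume "s \<in> vec 4" "t \<in> vec 4"
    then obtain s0 s1 s2 s3 t0 t1 t2 t3 where "s = bits [s0, s1, s2, s3]" "t = bits [t0, t1, t2, t3]"
      by (elim vec_4_eq_bits)
    then show "lin4 a (vadd s t) = vadd (lin4 a s) (lin4 a t)"
      by (simp add: a) argo
  qed
  show "inj_on (lin4 a) (vec 4)"
  proof (rule inj_onI)
    fix s t :: "nat \<Rightarrow> bool" assume "s \<in> vec 4" "t \<in> vec 4" and eq: "lin4 a s = lin4 a t"
    then obtain s0 s1 s2 s3 t0 t1 t2 t3 where "s = bits [s0, s1, s2, s3]" "t = bits [t0, t1, t2, t3]"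
      by (elim vec_4_eq_bits)
    with eq show "s = t"
      by (simp add: a) argo
  qed
  show "\<exists>s\<in>vec 4. sigma4 (vadd s a) \<noteq> vadd (sigma4 s) (sigma4 a)" if "a \<noteq> vzero"
  proof (rule ccontr)
    assume "\<not> ?thesis"
    then have lin: "sigma4 (vadd (bits [s0, s1, s2, s3]) a)
        = vadd (sigma4 (bits [s0, s1, s2, s3])) (sigma4 a)" for s0 s1 s2 s3
      by (simp add: bits_in_vec del: sigma4_def)
    \<comment> \<open>The first two unit vectors give \<open>a1 = 0\<close> and
      \<open>a0 = 0\<close>. The product \<open>a0 a1\<close> then drops out, and the last two give
      \<open>a3 = 0\<close> and \<open>a2 = 0\<close>.\<close>
    have "\<not> a0" "\<not> a1"
      using lin[of True False False False] lin[of False True False False] by (auto simp: a)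
    moreover from this have "\<not> a2" "\<not> a3"
      using lin[of False False True False] lin[of False False False True] by (auto simp: a)
    ultimately show False
      using that by (simp add: a vzero_eq_bits[of 4] numeral_eq_Suc)
  qed
  fix s :: "nat \<Rightarrow> bool" assume "s \<in> vec 4"
  then obtain s0 s1 s2 s3 where s: "s = bits [s0, s1, s2, s3]"
    by (rule vec_4_eq_bits)
  show "lin4 a s \<in> vec 4"
    by (simp add: bits_in_vec)
  show "sigma4 (vadd (lin4 a s) a) = vadd (lin4 (sigma4 a) (sigma4 s)) (sigma4 a)"
    by (simp add: a s) argo
qed

section \<open>Existence in all required dimensions\<close>

lemma ex_affine_involution:
  assumes "r \<ge> 3" "r \<noteq> 5"
  shows "\<exists>\<sigma> L. affine_involution r \<sigma> L"
  using assms
proof (induction r rule: less_induct)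
  case (less r)
  have sum: "\<exists>\<sigma> L. affine_involution (p + q) \<sigma> L"
    if "\<exists>\<sigma> L. affine_involution p \<sigma> L" "\<exists>\<sigma> L. affine_involution q \<sigma> L" for p q
    using that affine_involution_direct_sum by blast
  \<comment> \<open>For \<open>r\<close> at least 6, splitting off a summand of dimension 3 fails
    only when 5 remains, that is for \<open>r = 8\<close>, which is \<open>4 + 4\<close>.\<close>
  consider "r = 3" | "r = 4" | "r = 8" | "r - 3 \<ge> 3" "r - 3 \<noteq> 5" "r = 3 + (r - 3)"
    using less.prems by linarith
  then show ?case
  proof cases
    case 1
    then show ?thesis
      using affine_involution_3 by blast
  next
    case 2
    then show ?thesis
      using affine_involution_4 by blast
  next
    case 3
    then show ?thesis
      using sum[of 4 4] affine_involution_4 by auto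
  next
    case 4
    then show ?thesis
      using sum[of 3 "r - 3"] affine_involution_3 less.IH[of "r - 3"] less.prems by force
  qed
qed

theorem theorem7:
  fixes r :: nat
  assumes "r \<ge> 3" and "r \<noteq> 5"
  shows "\<exists>\<sigma>. bij_betw \<sigma> (vec r) (vec r) \<and> \<sigma> vzero = vzero
           \<and> ext_perfect (Scoords r) (Scode r \<sigma>)
           \<and> card (Scoords r) = 2 ^ (r + 1)
           \<and> neighbor_transitive (Scoords r) (Scode r \<sigma>)
           \<and> non_mollard (Scoords r) (Scode r \<sigma>)"
proof -
  obtain \<sigma> L where "affine_involution r \<sigma> L"
    using ex_affine_involution[OF assms] by blast
  then interpret affine_involution r \<sigma> L .
  show ?thesis
    using bij_sigma sigma_zero ext_perfect_Scode card_Scoords neighbor_transitive_Scode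
      non_mollard_Scode by blast
qed

end
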